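(* Under Assumptions A1, A2, A3, A4 and A5 (defined in the context), the optimal value $P^*$ of the peak estimation problem (P) and the optimal value $p^*_r$ of the sum-of-rational measure linear program (R) are equal: $P^*=p^*_r$.
   Context: Setting. Let $n,L\in\mathbb{N}$, $T>0$, $X\subseteq\mathbb{R}^n$ a state space and $X_0\subseteq X$ an initial set. The dynamics are rational: $\dot x(t)=f(t,x(t))$ with $$f(t,x)=f_0(t,x)+\sum_{\ell=1}^{L}\frac{N_\ell(t,x)}{D_\ell(t,x)},$$ where $f_0,N_\ell$ are $\mathbb{R}^n$-valued polynomials in $(t,x)$ and $D_\ell$ are real-valued polynomials in $(t,x)$. A trajectory starting at $x_0$ is an absolutely continuous curve $t\mapsto x(t\mid x_0)$ with $x(0\mid x_0)=x_0$ that satisfies the ODE for almost every $t$. Let $p:X\to\mathbb{R}$ be a state function. Peak estimation problem (P): $$P^*=\sup_{t^*,x_0}\ p(x(t^*\mid x_0))\quad\text{subject to } \dot x(t)=f(t,x(t)),\ t^*\in[0,T],\ x_0\in X_0,$$ where trajectories evolve in the state space $X$, i.e. $x(t\mid x_0)\in X$ for all $t\in[0,t^*]$. Notation. $\mathcal{M}_+(S)$ is the set of nonnegative Borel measures on $S$; $\langle g,\mu\rangle=\int g\,d\mu$; $C(S)$ is the set of continuous functions on $S$. $C^1([0,T]\times X)$ denotes functions that are $C^1$ (on a neighborhood of $[0,T]\times X$). For $v\in C^1([0,T]\times X)$, $\mathcal{L}_{f_0}v(t,x)=\partial_t v(t,x)+f_0(t,x)\cdot\nabla_x v(t,x)$.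 Sum-of-rational measure program (R): $$p^*_r=\sup\ \langle p,\mu_p\rangle$$ over $\mu_0\in\mathcal{M}_+(X_0)$ and $\mu,\mu_p,\nu_1,\dots,\nu_L\in\mathcal{M}_+([0,T]\times X)$ subject to: (i) $\mu_p=\delta_0\otimes\mu_0+\mathcal{L}_{f_0}^\dagger\mu+\sum_{\ell=1}^{L}(N_\ell\cdot\nabla_x)^\dagger\nu_\ell$, meaning that for all $v\in C^1([0,T]\times X)$, $$\langle v(t,x),\mu_p\rangle=\langle v(0,x),\mu_0\rangle+\langle\mathcal{L}_{f_0}v,\mu\rangle+\sum_{\ell=1}^{L}\langle N_\ell\cdot\nabla_x v,\nu_\ell\rangle;$$ (ii) for all $\ell$, $D_\ell^\dagger\nu_\ell=\mu$, meaning $\langle \omega D_\ell,\nu_\ell\rangle=\langle\omega,\mu\rangle$ for all $\omega\in C([0,T]\times X)$; (iii) $\langle 1,\mu_0\rangle=1$. Assumptions. A1 (non-return): if a trajectory satisfies $x(t\mid x_0)\notin X$ for some $x_0\in X_0$, then $x(t'\mid x_0)\notin X$ for all $t'\ge t$. A2: the set $[0,T]\times X_0\times X$ is compact. A3: the cost $p(x)$ is continuous. A4: trajectories of the ODE starting at $X_0$ in times $[0,T]$ are unique (any two trajectories with the same initial condition $x_0\in X_0$ agree where both are defined in $[0,T]$). A5: each function $D_\ell$ is strictly positive over $[0,T]\times X$. *)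

theory Defs
  imports "HOL-Analysis.Analysis"
begin

text \<open>
  Absolute continuity of a curve on \<open>{a..b}\<close>. A pair \<open>(u, v)\<close> stands for the interval
  \<open>{u..v}\<close>; only interiors have to be disjoint.
\<close>

definition absolutely_continuous_curve :: "real \<Rightarrow> real \<Rightarrow> (real \<Rightarrow> 'a::real_normed_vector) \<Rightarrow> bool"
  where "absolutely_continuous_curve a b x \<longleftrightarrow>
    (\<forall>\<epsilon>>0. \<exists>\<delta>>0. \<forall>J :: (real \<times> real) set.
       finite J \<and> (\<forall>(u, v)\<in>J. a \<le> u \<and> u \<le> v \<and> v \<le> b) \<and>
       disjoint_family_on (\<lambda>(u, v). {u<..<v}) J \<and>
       (\<Sum>(u, v)\<in>J. v - u) < \<delta>
       \<longrightarrow> (\<Sum>(u, v)\<in>J. norm (x v - x u)) < \<epsilon>)"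

definition rational_field ::
  "(real \<times> (real ^ 'n) \<Rightarrow> real ^ 'n) \<Rightarrow> nat \<Rightarrow> (nat \<Rightarrow> real \<times> (real ^ 'n) \<Rightarrow> real ^ 'n) \<Rightarrow>
   (nat \<Rightarrow> real \<times> (real ^ 'n) \<Rightarrow> real) \<Rightarrow> real \<times> (real ^ 'n) \<Rightarrow> real ^ 'n"
  where "rational_field f\<^sub>0 L N D z = f\<^sub>0 z + (\<Sum>l=1..L. N l z /\<^sub>R D l z)"

text \<open>
  A trajectory defined on \<open>{0..\<tau>}\<close>. The curve may leave the state space, where a denominator can
  vanish. Satisfying the ODE at a time includes that the right-hand side is defined there, so the
  totalised value of division by zero never counts.
\<close>

definition is_trajectory ::
  "(real \<times> (real ^ 'n) \<Rightarrow> real ^ 'n) \<Rightarrow> nat \<Rightarrow> (nat \<Rightarrow> real \<times> (real ^ 'n) \<Rightarrow> real ^ 'n) \<Rightarrow>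
   (nat \<Rightarrow> real \<times> (real ^ 'n) \<Rightarrow> real) \<Rightarrow> real ^ 'n \<Rightarrow> real \<Rightarrow> (real \<Rightarrow> real ^ 'n) \<Rightarrow> bool"
  where "is_trajectory f\<^sub>0 L N D x\<^sub>0 \<tau> x \<longleftrightarrow>
    absolutely_continuous_curve 0 \<tau> x \<and> x 0 = x\<^sub>0 \<and>
    (AE t in lborel. t \<in> {0..\<tau>} \<longrightarrow>
       (\<forall>l\<in>{1..L}. D l (t, x t) \<noteq> 0) \<and>
       (x has_vector_derivative rational_field f\<^sub>0 L N D (t, x t)) (at t within {0..\<tau>}))"

text \<open>
  Trajectories here and below need not stay in \<open>X\<close>, nor exist up to the horizon \<open>T\<close>; times beyond
  \<open>T\<close> play no role.
\<close>

definition non_return ::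
  "(real \<times> (real ^ 'n) \<Rightarrow> real ^ 'n) \<Rightarrow> nat \<Rightarrow> (nat \<Rightarrow> real \<times> (real ^ 'n) \<Rightarrow> real ^ 'n) \<Rightarrow>
   (nat \<Rightarrow> real \<times> (real ^ 'n) \<Rightarrow> real) \<Rightarrow> real \<Rightarrow> (real ^ 'n) set \<Rightarrow> (real ^ 'n) set \<Rightarrow> bool"
  where "non_return f\<^sub>0 L N D T X\<^sub>0 X \<longleftrightarrow>
    (\<forall>x\<^sub>0\<in>X\<^sub>0. \<forall>\<tau>\<in>{0..T}. \<forall>x. is_trajectory f\<^sub>0 L N D x\<^sub>0 \<tau> x \<longrightarrow>
       (\<forall>t\<in>{0..\<tau>}. x t \<notin> X \<longrightarrow> (\<forall>t'\<in>{t..\<tau>}. x t' \<notin> X)))"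

definition unique_trajectories ::
  "(real \<times> (real ^ 'n) \<Rightarrow> real ^ 'n) \<Rightarrow> nat \<Rightarrow> (nat \<Rightarrow> real \<times> (real ^ 'n) \<Rightarrow> real ^ 'n) \<Rightarrow>
   (nat \<Rightarrow> real \<times> (real ^ 'n) \<Rightarrow> real) \<Rightarrow> real \<Rightarrow> (real ^ 'n) set \<Rightarrow> bool"
  where "unique_trajectories f\<^sub>0 L N D T X\<^sub>0 \<longleftrightarrow>
    (\<forall>x\<^sub>0\<in>X\<^sub>0. \<forall>\<tau>\<in>{0..T}. \<forall>\<sigma>\<in>{0..T}. \<forall>x y.
       is_trajectory f\<^sub>0 L N D x\<^sub>0 \<tau> x \<and> is_trajectory f\<^sub>0 L N D x\<^sub>0 \<sigma> y \<longrightarrow>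
       (\<forall>t\<in>{0..\<tau>} \<inter> {0..\<sigma>}. x t = y t))"

definition peak_value ::
  "(real \<times> (real ^ 'n) \<Rightarrow> real ^ 'n) \<Rightarrow> nat \<Rightarrow> (nat \<Rightarrow> real \<times> (real ^ 'n) \<Rightarrow> real ^ 'n) \<Rightarrow>
   (nat \<Rightarrow> real \<times> (real ^ 'n) \<Rightarrow> real) \<Rightarrow> real \<Rightarrow> (real ^ 'n) set \<Rightarrow> (real ^ 'n) set \<Rightarrow>
   (real ^ 'n \<Rightarrow> real) \<Rightarrow> ereal"
  where "peak_value f\<^sub>0 L N D T X\<^sub>0 X p =
    Sup {ereal (p (x t\<^sub>e)) | x t\<^sub>e x\<^sub>0.
      t\<^sub>e \<in> {0..T} \<and> x\<^sub>0 \<in> X\<^sub>0 \<and> is_trajectory f\<^sub>0 L N D x\<^sub>0 t\<^sub>e x \<and> (\<forall>t\<in>{0..t\<^sub>e}. x t \<in> X)}"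

definition C1_on_nbhd :: "'a::real_normed_vector set \<Rightarrow> ('a \<Rightarrow> real) \<Rightarrow> bool"
  where "C1_on_nbhd S v \<longleftrightarrow>
    (\<exists>U v'. open U \<and> S \<subseteq> U \<and> continuous_on U v' \<and>
       (\<forall>z\<in>U. (v has_derivative blinfun_apply (v' z)) (at z)))"

definition time_deriv :: "(real \<times> (real ^ 'n) \<Rightarrow> real) \<Rightarrow> real \<times> (real ^ 'n) \<Rightarrow> real"
  where "time_deriv v = (\<lambda>(t, x). deriv (\<lambda>s. v (s, x)) t)"

definition space_grad :: "(real \<times> (real ^ 'n) \<Rightarrow> real) \<Rightarrow> real \<times> (real ^ 'n) \<Rightarrow> real ^ 'n"
  where "space_grad v = (\<lambda>(t, x). \<chi> i. frechet_derivative (\<lambda>y. v (t, y)) (at x) (axis i 1))"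

definition lie_deriv ::
  "(real \<times> (real ^ 'n) \<Rightarrow> real ^ 'n) \<Rightarrow> (real \<times> (real ^ 'n) \<Rightarrow> real) \<Rightarrow> real \<times> (real ^ 'n) \<Rightarrow> real"
  where "lie_deriv g v z = time_deriv v z + g z \<bullet> space_grad v z"

text \<open>
  The measures are required to be finite because they act on all of \<open>C(S)\<close>, constants included.
  Without this, the Bochner integral would silently assign 0 to non-integrable pairings. No feasible
  candidate is lost: testing with \<open>v = 1\<close>, \<open>v = t\<close> and \<open>\<omega> = 1\<close> bounds all masses on a compact set
  with positive denominators as soon as the pairings exist.
\<close>

definition borel_measures_on :: "'a::topological_space set \<Rightarrow> 'a measure set"
  where "borel_measures_on S = {\<mu>. sets \<mu> = sets (restrict_space borel S) \<and> finite_measure \<mu>}"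

definition feasible_sum_of_rational ::
  "(real \<times> (real ^ 'n) \<Rightarrow> real ^ 'n) \<Rightarrow> nat \<Rightarrow> (nat \<Rightarrow> real \<times> (real ^ 'n) \<Rightarrow> real ^ 'n) \<Rightarrow>
   (nat \<Rightarrow> real \<times> (real ^ 'n) \<Rightarrow> real) \<Rightarrow> real \<Rightarrow> (real ^ 'n) set \<Rightarrow> (real ^ 'n) set \<Rightarrow>
   (real ^ 'n) measure \<Rightarrow> (real \<times> (real ^ 'n)) measure \<Rightarrow> (real \<times> (real ^ 'n)) measure \<Rightarrow>
   (nat \<Rightarrow> (real \<times> (real ^ 'n)) measure) \<Rightarrow> bool"
  where "feasible_sum_of_rational f\<^sub>0 L N D T X\<^sub>0 X \<mu>\<^sub>0 \<mu> \<mu>\<^sub>p \<nu> \<longleftrightarrow>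
    \<mu>\<^sub>0 \<in> borel_measures_on X\<^sub>0 \<and>
    \<mu> \<in> borel_measures_on ({0..T} \<times> X) \<and>
    \<mu>\<^sub>p \<in> borel_measures_on ({0..T} \<times> X) \<and>
    (\<forall>l\<in>{1..L}. \<nu> l \<in> borel_measures_on ({0..T} \<times> X)) \<and>
    (\<forall>v. C1_on_nbhd ({0..T} \<times> X) v \<longrightarrow>
       (\<integral>z. v z \<partial>\<mu>\<^sub>p) = (\<integral>x. v (0, x) \<partial>\<mu>\<^sub>0) + (\<integral>z. lie_deriv f\<^sub>0 v z \<partial>\<mu>)
         + (\<Sum>l=1..L. \<integral>z. N l z \<bullet> space_grad v z \<partial>\<nu> l)) \<and>
    (\<forall>l\<in>{1..L}. \<forall>\<omega>. continuous_on ({0..T} \<times> X) \<omega> \<longrightarrow>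
       (\<integral>z. \<omega> z * D l z \<partial>\<nu> l) = (\<integral>z. \<omega> z \<partial>\<mu>)) \<and>
    (\<integral>x. 1 \<partial>\<mu>\<^sub>0) = (1::real)"

definition sum_of_rational_value ::
  "(real \<times> (real ^ 'n) \<Rightarrow> real ^ 'n) \<Rightarrow> nat \<Rightarrow> (nat \<Rightarrow> real \<times> (real ^ 'n) \<Rightarrow> real ^ 'n) \<Rightarrow>
   (nat \<Rightarrow> real \<times> (real ^ 'n) \<Rightarrow> real) \<Rightarrow> real \<Rightarrow> (real ^ 'n) set \<Rightarrow> (real ^ 'n) set \<Rightarrow>
   (real ^ 'n \<Rightarrow> real) \<Rightarrow> ereal"
  where "sum_of_rational_value f\<^sub>0 L N D T X\<^sub>0 X p =
    Sup {ereal (\<integral>(t, x). p x \<partial>\<mu>\<^sub>p) | \<mu>\<^sub>0 \<mu> \<mu>\<^sub>p \<nu>.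
      feasible_sum_of_rational f\<^sub>0 L N D T X\<^sub>0 X \<mu>\<^sub>0 \<mu> \<mu>\<^sub>p \<nu>}"

end

theory Submission
  imports Defs "HOL-Probability.Giry_Monad"
begin

text \<open>
  Put \<open>\<Omega> = {0..T} \<times> X\<close> and let \<open>f\<close> be the rational field.

  A trajectory that stays in \<open>X\<close> up to time \<open>\<tau>\<close> yields a feasible point: \<open>\<mu>\<close> is its occupation
  measure, \<open>\<mu>\<^sub>0\<close> and \<open>\<mu>\<^sub>p\<close> are the Dirac measures at its two ends, and \<open>\<nu> l\<close> has density \<open>1 / D l\<close>
  with respect to \<open>\<mu>\<close>. Then \<open>\<integral>p d\<mu>\<^sub>p\<close> is the value of the trajectory. The Liouville equation for these
  measures is the fundamental theorem of calculus along the trajectory. It applies because the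
  trajectory, although only absolutely continuous by definition, is \<open>C\<^sup>1\<close>: its derivative is almost
  everywhere equal to the continuous function \<open>f(t, x(t))\<close>. This uses the fundamental theorem of
  calculus for absolutely continuous curves, proved below with gauges.

  For the other inequality, elimination of the \<open>\<nu> l\<close> turns feasibility into
  \<open>\<integral>v d\<mu>\<^sub>p = \<integral>v(0,\<cdot>) d\<mu>\<^sub>0 + \<integral>\<L>\<^sub>f v d\<mu>\<close> for all \<open>C\<^sup>1\<close> functions \<open>v\<close>. It then suffices that \<open>\<mu>\<^sub>p\<close>-almost
  every point \<open>(t, x)\<close> is the end of a trajectory which starts in \<open>X\<^sub>0\<close> and stays in \<open>X\<close>; then \<open>p\<close> is
  \<open>\<mu>\<^sub>p\<close>-almost everywhere at most the peak value, and \<open>\<mu>\<^sub>p\<close> has mass 1. No decomposition of \<open>\<mu>\<close> into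
  trajectories is required. Extend \<open>f\<close> from \<open>\<Omega>\<close> to a globally Lipschitz field \<open>F\<close>, let \<open>(t\<^sub>1, x\<^sub>1)\<close> be
  a point that is not such an end, and let \<open>y\<close> solve \<open>y' = F(t, y)\<close>, \<open>y(t\<^sub>1) = x\<^sub>1\<close>. Followed backwards
  from \<open>t\<^sub>1\<close>, the curve \<open>y\<close> either leaves \<open>X\<close> or arrives at time 0 outside \<open>X\<^sub>0\<close>. Around \<open>y\<close> there is a
  tube whose radius decreases like \<open>exp (- K t)\<close>, where \<open>K\<close> is the Lipschitz constant of \<open>F\<close>; no
  solution enters it from outside. A \<open>C\<^sup>1\<close> function \<open>v \<ge> 0\<close> which is positive exactly on the tube
  therefore has \<open>\<L>\<^sub>f v \<le> 0\<close> on \<open>\<Omega>\<close>. The tube is narrow enough to begin outside \<open>X\<close> or to miss \<open>X\<^sub>0\<close> at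
  time 0, hence \<open>v(0,\<cdot>) = 0\<close> on \<open>X\<^sub>0\<close>. The Liouville equation gives \<open>\<integral>v d\<mu>\<^sub>p \<le> 0\<close>, so that the tube, a
  neighbourhood of \<open>(t\<^sub>1, x\<^sub>1)\<close>, is \<open>\<mu>\<^sub>p\<close>-null. By the Lindelof property countably many such tubes
  cover all points of this kind.
\<close>

section \<open>Absolutely continuous curves\<close>

lemma lipschitz_imp_absolutely_continuous_curve:
  fixes x :: "real \<Rightarrow> 'a::real_normed_vector"
  assumes lip: "C-lipschitz_on {a..b} x"
  shows "absolutely_continuous_curve a b x"
  unfolding absolutely_continuous_curve_def
proof (intro allI impI)
  fix \<epsilon> :: real
  assume "\<epsilon> > 0"
  have C: "C \<ge> 0"
    using lip by (rule lipschitz_on_nonneg)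
  show "\<exists>\<delta>>0. \<forall>J :: (real \<times> real) set.
       finite J \<and> (\<forall>(u, v)\<in>J. a \<le> u \<and> u \<le> v \<and> v \<le> b) \<and>
       disjoint_family_on (\<lambda>(u, v). {u<..<v}) J \<and> (\<Sum>(u, v)\<in>J. v - u) < \<delta>
       \<longrightarrow> (\<Sum>(u, v)\<in>J. norm (x v - x u)) < \<epsilon>"
  proof (intro exI conjI allI impI)
    show "\<epsilon> / (C + 1) > 0"
      using C \<open>\<epsilon> > 0\<close> by simp
    fix J :: "(real \<times> real) set"
    assume J: "finite J \<and> (\<forall>(u, v)\<in>J. a \<le> u \<and> u \<le> v \<and> v \<le> b) \<and>
       disjoint_family_on (\<lambda>(u, v). {u<..<v}) J \<and> (\<Sum>(u, v)\<in>J. v - u) < \<epsilon> / (C + 1)"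
    have "(\<Sum>(u, v)\<in>J. norm (x v - x u)) \<le> (\<Sum>(u, v)\<in>J. C * (v - u))"
    proof (intro sum_mono, clarify)
      fix u v
      assume "(u, v) \<in> J"
      then have uv: "a \<le> u" "u \<le> v" "v \<le> b"
        using J by auto
      show "norm (x v - x u) \<le> C * (v - u)"
        using lipschitz_on_normD[OF lip, of v u] uv by auto
    qed
    also have "\<dots> = C * (\<Sum>(u, v)\<in>J. v - u)"
      by (simp add: sum_distrib_left case_prod_unfold)
    also have "\<dots> \<le> C * (\<epsilon> / (C + 1))"
      using J C by (intro mult_left_mono) auto
    also have "\<dots> < \<epsilon>"
      using C \<open>\<epsilon> > 0\<close> by (simp add: field_simps)
    finally show "(\<Sum>(u, v)\<in>J. norm (x v - x u)) < \<epsilon>" .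
  qed
qed

lemma absolutely_continuous_curve_subinterval:
  assumes "absolutely_continuous_curve a b x" "a \<le> c" "d \<le> b"
  shows "absolutely_continuous_curve c d x"
  unfolding absolutely_continuous_curve_def
proof (intro allI impI)
  fix \<epsilon> :: real
  assume "\<epsilon> > 0"
  then obtain \<delta> where "\<delta> > 0" and \<delta>: "\<And>J :: (real \<times> real) set.
       finite J \<and> (\<forall>(u, v)\<in>J. a \<le> u \<and> u \<le> v \<and> v \<le> b) \<and>
       disjoint_family_on (\<lambda>(u, v). {u<..<v}) J \<and> (\<Sum>(u, v)\<in>J. v - u) < \<delta>
       \<Longrightarrow> (\<Sum>(u, v)\<in>J. norm (x v - x u)) < \<epsilon>"
    using assms(1) unfolding absolutely_continuous_curve_def by meson
  show "\<exists>\<delta>>0. \<forall>J :: (real \<times> real) set.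
       finite J \<and> (\<forall>(u, v)\<in>J. c \<le> u \<and> u \<le> v \<and> v \<le> d) \<and>
       disjoint_family_on (\<lambda>(u, v). {u<..<v}) J \<and> (\<Sum>(u, v)\<in>J. v - u) < \<delta>
       \<longrightarrow> (\<Sum>(u, v)\<in>J. norm (x v - x u)) < \<epsilon>"
    using \<open>\<delta> > 0\<close> assms(2,3) by (intro exI[of _ \<delta>] conjI allI impI \<delta>) fastforce+
qed

lemma absolutely_continuous_curve_imp_continuous_on:
  fixes x :: "real \<Rightarrow> 'a::real_normed_vector"
  assumes "absolutely_continuous_curve a b x"
  shows "continuous_on {a..b} x"
  unfolding continuous_on_iff
proof (intro ballI allI impI)
  fix s \<epsilon> :: real
  assume s: "s \<in> {a..b}" and "\<epsilon> > 0"
  then obtain \<delta> where "\<delta> > 0" and \<delta>: "\<And>J :: (real \<times> real) set.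
       finite J \<and> (\<forall>(u, v)\<in>J. a \<le> u \<and> u \<le> v \<and> v \<le> b) \<and>
       disjoint_family_on (\<lambda>(u, v). {u<..<v}) J \<and> (\<Sum>(u, v)\<in>J. v - u) < \<delta>
       \<Longrightarrow> (\<Sum>(u, v)\<in>J. norm (x v - x u)) < \<epsilon>"
    using assms unfolding absolutely_continuous_curve_def by meson
  show "\<exists>d>0. \<forall>t\<in>{a..b}. dist t s < d \<longrightarrow> dist (x t) (x s) < \<epsilon>"
  proof (intro exI[of _ \<delta>] conjI ballI impI)
    fix t
    assume t: "t \<in> {a..b}" "dist t s < \<delta>"
    have "norm (x (max s t) - x (min s t)) < \<epsilon>"
      using \<delta>[of "{(min s t, max s t)}"] s t
      by (auto simp: disjoint_family_on_def dist_real_def min_def max_def)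
    then show "dist (x t) (x s) < \<epsilon>"
      by (auto simp: dist_norm min_def max_def norm_minus_commute split: if_splits)
  qed fact
qed

text \<open>
  The Henstock-Kurzweil integral is a limit of sums over gauge-fine divisions, which treats the two
  kinds of tags separately. At a tag outside \<open>E\<close> the gauge makes the difference quotient accurate. At a
  tag in \<open>E\<close> the gauge keeps the interval inside an open set of small measure around \<open>E\<close>, so that
  absolute continuity bounds the total increment of \<open>x\<close> over these intervals.
\<close>

theorem fundamental_theorem_of_calculus_absolutely_continuous:
  fixes x :: "real \<Rightarrow> 'a::banach"
  assumes ac: "absolutely_continuous_curve a b x" and ab: "a \<le> b"
    and E: "E \<in> null_sets lborel"
    and der: "\<And>t. t \<in> {a..b} \<Longrightarrow> t \<notin> E \<Longrightarrow> (x has_vector_derivative g t) (at t within {a..b})"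
  shows "(g has_integral (x b - x a)) {a..b}"
proof -
  \<comment> \<open>Nothing is known about g on E; changing it to 0 there does not affect the integral.\<close>
  define h where "h t = (if t \<in> E then 0 else g t)" for t
  have "(h has_integral (x b - x a)) {a..b}"
    unfolding has_integral_real
  proof (intro allI impI)
    fix e :: real
    assume e: "e > 0"
    define \<eta> where "\<eta> = e / (2 * (b - a + 1))"
    have \<eta>: "\<eta> > 0" "\<eta> * (b - a) < e / 2"
      using e ab by (auto simp: \<eta>_def field_simps)
    obtain \<delta> where "\<delta> > 0" and \<delta>: "\<And>J :: (real \<times> real) set.
       finite J \<and> (\<forall>(u, v)\<in>J. a \<le> u \<and> u \<le> v \<and> v \<le> b) \<and>
       disjoint_family_on (\<lambda>(u, v). {u<..<v}) J \<and> (\<Sum>(u, v)\<in>J. v - u) < \<delta>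
       \<Longrightarrow> (\<Sum>(u, v)\<in>J. norm (x v - x u)) < e / 2"
      using ac half_gt_zero[OF e] unfolding absolutely_continuous_curve_def by meson
    obtain G where G: "open G" "E \<subseteq> G" "emeasure lborel (G - E) < \<delta>"
      by (rule outer_regular_lborel[of E \<delta>]) (use E \<open>\<delta> > 0\<close> in auto)
    have G_meas: "emeasure lborel G < \<delta>"
      using G E by (metis emeasure_Diff_null_set open_closed borel_open sets_lborel)
    have near: "\<exists>d>0. \<forall>s\<in>{a..b}. \<bar>s - t\<bar> < d \<longrightarrow> norm (x s - x t - (s - t) *\<^sub>R g t) \<le> \<eta> * \<bar>s - t\<bar>"
      if "t \<in> {a..b}" "t \<notin> E" for t
      using der[OF that] \<eta>(1)
      unfolding has_vector_derivative_def has_derivative_within_alt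
      by auto
    have "\<forall>t. \<exists>d>0. (t \<in> E \<longrightarrow> ball t d \<subseteq> G) \<and>
        (t \<in> {a..b} - E \<longrightarrow> (\<forall>s\<in>{a..b}. \<bar>s - t\<bar> < d \<longrightarrow> norm (x s - x t - (s - t) *\<^sub>R g t) \<le> \<eta> * \<bar>s - t\<bar>))"
      using near G by (metis DiffD1 DiffD2 open_contains_ball subsetD zero_less_one)
    then obtain d where d: "\<And>t. d t > 0" "\<And>t. t \<in> E \<Longrightarrow> ball t (d t) \<subseteq> G"
      "\<And>t s. t \<in> {a..b} - E \<Longrightarrow> s \<in> {a..b} \<Longrightarrow> \<bar>s - t\<bar> < d t \<Longrightarrow>
         norm (x s - x t - (s - t) *\<^sub>R g t) \<le> \<eta> * \<bar>s - t\<bar>"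
      by metis
    show "\<exists>\<gamma>. gauge \<gamma> \<and> (\<forall>p. p tagged_division_of {a..b} \<and> \<gamma> fine p \<longrightarrow>
        norm ((\<Sum>(t, k)\<in>p. measure lborel k *\<^sub>R h t) - (x b - x a)) < e)"
    proof (intro exI[of _ "\<lambda>t. ball t (d t)"] conjI allI impI)
      show "gauge (\<lambda>t. ball t (d t))"
        using d(1) by (simp add: gauge_def)
      fix p
      assume "p tagged_division_of {a..b} \<and> (\<lambda>t. ball t (d t)) fine p"
      then have p: "p tagged_division_of {a..b}" and fine: "\<And>t k. (t, k) \<in> p \<Longrightarrow> k \<subseteq> ball t (d t)"
        by (auto simp: fine_def)
      have fin: "finite p"
        using p by blast
      have cell: "\<exists>u v. k = {u..v} \<and> a \<le> u \<and> u \<le> t \<and> t \<le> v \<and> v \<le> b" if "(t, k) \<in> p" for t k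
      proof -
        have "t \<in> k" "k \<subseteq> {a..b}" "\<exists>u v. k = {u..v}"
          using p that by (auto simp: tagged_division_of_def tagged_partial_division_of_def)
        then show ?thesis by auto
      qed
      have telescope: "(\<Sum>(t, k)\<in>p. x (Sup k) - x (Inf k)) = x b - x a"
        using additive_tagged_division_1[OF ab p] by simp
      define pE where "pE = {(t, k) \<in> p. t \<in> E}"
      \<comment> \<open>Degenerate intervals contribute nothing. For the others, disjointness of the interiors
        shows that a tagged interval is determined by its end points.\<close>
      define pN where "pN = {(t, k) \<in> pE. interior k \<noteq> {}}"
      have pE: "pE \<subseteq> p" "finite pE" and pN: "pN \<subseteq> pE" "finite pN"
        using fin by (auto simp: pE_def pN_def intro: finite_subset)
      have good: "norm (measure lborel k *\<^sub>R h t - (x (Sup k) - x (Inf k))) \<le> \<eta> * measure lborel k"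
        if tk: "(t, k) \<in> p - pE" for t k
      proof -
        obtain u v where uv: "k = {u..v}" "a \<le> u" "u \<le> t" "t \<le> v" "v \<le> b"
          using cell tk by blast
        have t: "t \<in> {a..b} - E"
          using uv tk by (auto simp: pE_def)
        have "k \<subseteq> ball t (d t)"
          using fine tk by auto
        moreover have "u \<in> k" "v \<in> k"
          using uv by auto
        ultimately have "\<bar>u - t\<bar> < d t" "\<bar>v - t\<bar> < d t"
          by (auto simp: subset_iff dist_real_def abs_minus_commute)
        then have less: "norm (x u - x t - (u - t) *\<^sub>R g t) \<le> \<eta> * \<bar>u - t\<bar>"
          "norm (x v - x t - (v - t) *\<^sub>R g t) \<le> \<eta> * \<bar>v - t\<bar>"
          using d(3)[of t u] d(3)[of t v] t uv by auto
        have split: "measure lborel k *\<^sub>R h t - (x (Sup k) - x (Inf k))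
            = (x u - x t - (u - t) *\<^sub>R g t) - (x v - x t - (v - t) *\<^sub>R g t)"
          using t uv by (simp add: h_def algebra_simps)
        have "norm (measure lborel k *\<^sub>R h t - (x (Sup k) - x (Inf k)))
            \<le> \<eta> * \<bar>u - t\<bar> + \<eta> * \<bar>v - t\<bar>"
          unfolding split using norm_triangle_ineq4 add_mono[OF less] by (rule order_trans)
        also have "\<dots> = \<eta> * measure lborel k"
          using uv by (simp add: algebra_simps)
        finally show ?thesis .
      qed
      have "norm ((\<Sum>(t, k)\<in>p. measure lborel k *\<^sub>R h t) - (x b - x a))
          = norm (\<Sum>(t, k)\<in>p. measure lborel k *\<^sub>R h t - (x (Sup k) - x (Inf k)))"
        unfolding telescope[symmetric] by (simp add: sum_subtractf case_prod_unfold)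
      also have "\<dots> \<le> (\<Sum>(t, k)\<in>p. norm (measure lborel k *\<^sub>R h t - (x (Sup k) - x (Inf k))))"
        by (simp add: case_prod_unfold norm_sum)
      also have "\<dots> = (\<Sum>(t, k)\<in>p - pE. norm (measure lborel k *\<^sub>R h t - (x (Sup k) - x (Inf k))))
          + (\<Sum>(t, k)\<in>pE. norm (measure lborel k *\<^sub>R h t - (x (Sup k) - x (Inf k))))"
        using fin pE by (simp add: sum.subset_diff)
      also have "(\<Sum>(t, k)\<in>p - pE. norm (measure lborel k *\<^sub>R h t - (x (Sup k) - x (Inf k))))
          \<le> (\<Sum>(t, k)\<in>p - pE. \<eta> * measure lborel k)"
        using good by (intro sum_mono) auto
      also have "\<dots> \<le> (\<Sum>(t, k)\<in>p. \<eta> * measure lborel k)"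
        using fin \<eta> by (intro sum_mono2) auto
      also have "\<dots> = \<eta> * (b - a)"
        using additive_content_tagged_division[of p a b] p ab
        by (simp add: sum_distrib_left[symmetric] case_prod_unfold)
      also have "\<dots> < e / 2" by (rule \<eta>)
      also have "(\<Sum>(t, k)\<in>pE. norm (measure lborel k *\<^sub>R h t - (x (Sup k) - x (Inf k)))) < e / 2"
      proof -
        \<comment> \<open>The pairs of end points of the intervals tagged in E form an admissible family for the
          absolute continuity of x, with total length below the threshold.\<close>
        define ends :: "real \<times> real set \<Rightarrow> real \<times> real" where "ends = (\<lambda>(t, k). (Inf k, Sup k))"
        define J where "J = ends ` pN"
        have pN_cell: "\<exists>u v. k = {u..v} \<and> ends (t, k) = (u, v) \<and> a \<le> u \<and> u < v \<and> v \<le> b"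
          if "(t, k) \<in> pN" for t k
        proof -
          have "(t, k) \<in> p" "interior k \<noteq> {}"
            using that by (auto simp: pN_def pE_def)
          then show ?thesis
            using cell[of t k] by (fastforce simp: ends_def)
        qed
        have disj: "interior k \<inter> interior k' = {}"
          if "(t, k) \<in> pN" "(t', k') \<in> pN" "(t, k) \<noteq> (t', k')" for t k t' k'
        proof -
          have "(t, k) \<in> p" "(t', k') \<in> p"
            using that by (auto simp: pN_def pE_def)
          then show ?thesis
            using p that(3) unfolding tagged_division_of_def tagged_partial_division_of_def by blast
        qed
        have inj: "inj_on ends pN"
        proof (rule inj_onI, clarify)
          fix t k t' k'
          assume A: "(t, k) \<in> pN" "(t', k') \<in> pN" "ends (t, k) = ends (t', k')"
          then have "k = k'"
            using pN_cell[OF A(1)] pN_cell[OF A(2)] by auto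
          moreover have "interior k \<noteq> {}"
            using A(1) by (auto simp: pN_def)
          ultimately show "t = t' \<and> k = k'"
            using disj[OF A(1,2)] by auto
        qed
        have J_sub: "finite J" "\<forall>(u, v)\<in>J. a \<le> u \<and> u \<le> v \<and> v \<le> b"
          using pN pN_cell by (fastforce simp: J_def)+
        have J_disj: "disjoint_family_on (\<lambda>(u, v). {u<..<v}) J"
          unfolding disjoint_family_on_def
        proof (intro ballI impI)
          fix i j
          assume ij: "i \<in> J" "j \<in> J" "i \<noteq> j"
          then obtain t k t' k' where A: "(t, k) \<in> pN" "i = ends (t, k)" "(t', k') \<in> pN" "j = ends (t', k')"
            by (auto simp: J_def)
          then have "(t, k) \<noteq> (t', k')"
            using ij by auto
          with disj A have "interior k \<inter> interior k' = {}" by blast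
          then show "(case i of (u, v) \<Rightarrow> {u<..<v}) \<inter> (case j of (u, v) \<Rightarrow> {u<..<v}) = {}"
            using pN_cell[OF A(1)] pN_cell[OF A(3)] A by auto
        qed
        have "ennreal (\<Sum>(u, v)\<in>J. v - u) = (\<Sum>(u, v)\<in>J. emeasure lborel {u<..<v})"
          using J_sub by (subst sum_ennreal[symmetric]) (auto intro!: sum.cong)
        also have "\<dots> = emeasure lborel (\<Union>i\<in>J. case i of (u, v) \<Rightarrow> {u<..<v})"
          using J_sub J_disj
          by (subst sum_emeasure[symmetric]) (auto simp: case_prod_unfold)
        also have "\<dots> \<le> emeasure lborel G"
        proof (rule emeasure_mono)
          show "(\<Union>i\<in>J. case i of (u, v) \<Rightarrow> {u<..<v}) \<subseteq> G"
          proof (clarify)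
            fix s u v
            assume "(u, v) \<in> J" and s: "s \<in> {u<..<v}"
            then obtain t k where A: "(t, k) \<in> pN" "(u, v) = ends (t, k)"
              by (auto simp: J_def)
            then have "s \<in> k" "t \<in> E" "(t, k) \<in> p"
              using pN_cell[OF A(1)] s by (auto simp: pN_def pE_def)
            then show "s \<in> G"
              using fine d(2) by blast
          qed
        qed (use G in auto)
        also have "\<dots> < ennreal \<delta>"
          using G_meas .
        finally have "(\<Sum>(u, v)\<in>J. v - u) < \<delta>"
          using \<open>\<delta> > 0\<close> by (simp add: ennreal_less_iff ennreal_lessI)
             (metis (no_types, lifting) \<open>\<delta> > 0\<close> ennreal_leI linorder_not_less)
        then have "(\<Sum>(u, v)\<in>J. norm (x v - x u)) < e / 2"
          using J_sub J_disj by (intro \<delta>) auto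
        also have "(\<Sum>(u, v)\<in>J. norm (x v - x u)) = (\<Sum>(t, k)\<in>pN. norm (x (Sup k) - x (Inf k)))"
          unfolding J_def by (subst sum.reindex[OF inj]) (simp add: ends_def case_prod_unfold)
        also have "\<dots> = (\<Sum>(t, k)\<in>pE. norm (measure lborel k *\<^sub>R h t - (x (Sup k) - x (Inf k))))"
        proof (rule sum.mono_neutral_cong_left[OF pE(2) pN(1)])
          show "\<forall>i\<in>pE - pN. (case i of (t, k) \<Rightarrow> norm (measure lborel k *\<^sub>R h t - (x (Sup k) - x (Inf k)))) = 0"
          proof clarify
            fix t k
            assume A: "(t, k) \<in> pE" "(t, k) \<notin> pN"
            then obtain u v where uv: "k = {u..v}" "u \<le> t" "t \<le> v" and tE: "t \<in> E"
              using cell[of t k] by (auto simp: pE_def)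
            have "interior k = {}"
              using A by (auto simp: pN_def)
            then have "u = v"
              using uv by (auto simp: interior_atLeastAtMost_real)
            then show "norm (measure lborel k *\<^sub>R h t - (x (Sup k) - x (Inf k))) = 0"
              using tE uv by (simp add: h_def)
          qed
        qed (auto simp: pN_def pE_def h_def norm_minus_commute)
        finally show ?thesis .
      qed
      finally show "norm ((\<Sum>(t, k)\<in>p. measure lborel k *\<^sub>R h t) - (x b - x a)) < e" by simp
    qed
  qed
  then show ?thesis
  proof (rule has_integral_spike[rotated 2])
    show "negligible E"
      using E by (simp add: negligible_iff_null_sets null_sets_completionI)
  qed (simp add: h_def)
qed

section \<open>Lipschitz extension of rational vector fields\<close>

lemma bounded_lipschitz_image:
  assumes f: "C-lipschitz_on S f" and S: "bounded S"
  shows "bounded (f ` S)"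
proof -
  obtain z r where r: "\<And>x. x \<in> S \<Longrightarrow> dist z x \<le> r"
    using S by (auto simp: bounded_def)
  have "bounded (f ` S)" if w: "w \<in> S" for w
  proof -
    have "dist (f w) (f x) \<le> C * (r + r)" if "x \<in> S" for x
    proof -
      have "dist (f w) (f x) \<le> C * dist w x"
        using lipschitz_onD[OF f w that] .
      also have "\<dots> \<le> C * (r + r)"
        using r[OF w] r[OF that] lipschitz_on_nonneg[OF f] dist_triangle3[of w x z]
        by (intro mult_left_mono) auto
      finally show ?thesis .
    qed
    then show ?thesis
      by (auto simp: bounded_def)
  qed
  then show ?thesis
    by (cases "S = {}") auto
qed

lemma lipschitz_on_scaleR_bounded:
  fixes f :: "'a::metric_space \<Rightarrow> real" and g :: "'a \<Rightarrow> 'b::real_normed_vector"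
  assumes S: "bounded S" and f: "A-lipschitz_on S f" and g: "B-lipschitz_on S g"
  shows "\<exists>C. C-lipschitz_on S (\<lambda>x. f x *\<^sub>R g x)"
proof -
  have "bounded (f ` S)" "bounded (g ` S)"
    using S f g by (auto intro: bounded_lipschitz_image)
  then obtain a b where a: "a > 0" "\<And>x. x \<in> S \<Longrightarrow> \<bar>f x\<bar> \<le> a" and b: "b > 0" "\<And>x. x \<in> S \<Longrightarrow> norm (g x) \<le> b"
    by (auto simp: bounded_pos)
  have A: "A \<ge> 0" and B: "B \<ge> 0"
    using f g by (auto intro: lipschitz_on_nonneg)
  have "(A * b + a * B)-lipschitz_on S (\<lambda>x. f x *\<^sub>R g x)"
  proof (rule lipschitz_onI)
    fix x y
    assume xy: "x \<in> S" "y \<in> S"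
    have "dist (f x *\<^sub>R g x) (f y *\<^sub>R g y) = norm ((f x - f y) *\<^sub>R g x + f y *\<^sub>R (g x - g y))"
      by (simp add: dist_norm algebra_simps)
    also have "\<dots> \<le> \<bar>f x - f y\<bar> * norm (g x) + \<bar>f y\<bar> * norm (g x - g y)"
      by (rule order_trans[OF norm_triangle_ineq]) simp
    also have "\<dots> \<le> (A * dist x y) * b + a * (B * dist x y)"
      using lipschitz_onD[OF f xy] lipschitz_onD[OF g xy] a b xy A B
      by (intro add_mono mult_mono) (auto simp: dist_norm)
    finally show "dist (f x *\<^sub>R g x) (f y *\<^sub>R g y) \<le> (A * b + a * B) * dist x y"
      by (simp add: algebra_simps)
  qed (use A B a b in auto)
  then show ?thesis ..
qed

lemma lipschitz_on_sum:
  fixes f :: "'i \<Rightarrow> 'a::metric_space \<Rightarrow> 'b::real_normed_vector"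
  assumes "finite I" "\<And>i. i \<in> I \<Longrightarrow> \<exists>C. C-lipschitz_on S (f i)"
  shows "\<exists>C. C-lipschitz_on S (\<lambda>x. \<Sum>i\<in>I. f i x)"
  using assms
proof (induction I)
  case empty
  show ?case
    by (rule exI[of _ 0]) (simp add: lipschitz_on_constant)
next
  case (insert i I)
  then obtain A B where "A-lipschitz_on S (f i)" "B-lipschitz_on S (\<lambda>x. \<Sum>i\<in>I. f i x)"
    by blast
  then have "(A + B)-lipschitz_on S (\<lambda>x. f i x + (\<Sum>i\<in>I. f i x))"
    by (rule lipschitz_on_add)
  then show ?case
    using insert by auto
qed

lemma polynomial_function_lipschitz_on_bounded:
  fixes p :: "'a::real_normed_vector \<Rightarrow> 'b::euclidean_space"
  assumes S: "bounded S" and p: "polynomial_function p"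
  shows "\<exists>C. C-lipschitz_on S p"
proof -
  have real_case: "\<exists>C. C-lipschitz_on S q" if "real_polynomial_function q" for q :: "'a \<Rightarrow> real"
    using that
  proof (induction q)
    case (linear f)
    then obtain B where B: "\<And>x. norm (f x) \<le> norm x * B" "B \<ge> 0"
      using bounded_linear.nonneg_bounded by blast
    have "B-lipschitz_on S f"
      using B linear by (auto intro!: lipschitz_onI simp: dist_norm mult.commute linear_diff[symmetric] bounded_linear.linear)
    then show ?case ..
  next
    case (mult f g)
    then obtain A B where "A-lipschitz_on S f" "B-lipschitz_on S g"
      by blast
    from lipschitz_on_scaleR_bounded[OF S this] show ?case
      by simp
  next
    case (const c)
    show ?case
      using lipschitz_on_constant by blast
  next
    case (add f g)
    then obtain A B where "A-lipschitz_on S f" "B-lipschitz_on S g"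
      by blast
    from lipschitz_on_add[OF this] show ?case ..
  qed
  have "\<exists>C. C-lipschitz_on S (\<lambda>x. (p x \<bullet> b) *\<^sub>R b)" for b
  proof -
    have "real_polynomial_function (\<lambda>x. p x \<bullet> b)"
      using p bounded_linear_inner_left[of b] by (auto simp: polynomial_function_def o_def)
    from real_case[OF this] obtain A where "A-lipschitz_on S (\<lambda>x. p x \<bullet> b)" ..
    from lipschitz_on_scaleR_bounded[OF S this lipschitz_on_constant] show ?thesis .
  qed
  then have "\<exists>C. C-lipschitz_on S (\<lambda>x. \<Sum>b\<in>Basis. (p x \<bullet> b) *\<^sub>R b)"
    by (intro lipschitz_on_sum) auto
  then show ?thesis
    by (simp add: euclidean_representation)
qed

text \<open>
  Truncating the denominator from below makes its reciprocal Lipschitz wherever the denominator is,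
  also where it vanishes.
\<close>

lemma lipschitz_on_inverse_max:
  fixes D :: "'a::metric_space \<Rightarrow> real"
  assumes c: "c > 0" and D: "A-lipschitz_on S D"
  shows "(A / c\<^sup>2)-lipschitz_on S (\<lambda>z. inverse (max c (D z)))"
proof (rule lipschitz_onI)
  fix x y
  assume xy: "x \<in> S" "y \<in> S"
  let ?a = "max c (D x)" and ?b = "max c (D y)"
  have pos: "c \<le> ?a" "c \<le> ?b" "0 < ?a" "0 < ?b"
    using c by auto
  have "c\<^sup>2 \<le> ?a * ?b"
    using pos c by (simp add: power2_eq_square mult_mono)
  have "dist (inverse ?a) (inverse ?b) = \<bar>?b - ?a\<bar> / (?a * ?b)"
    using pos by (simp add: dist_real_def field_simps abs_mult)
  also have "\<dots> \<le> \<bar>?b - ?a\<bar> / c\<^sup>2"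
    using \<open>c\<^sup>2 \<le> ?a * ?b\<close> c by (intro divide_left_mono) auto
  also have "\<bar>?b - ?a\<bar> \<le> dist (D x) (D y)"
    unfolding dist_real_def by linarith
  also have "\<dots> \<le> A * dist x y"
    using lipschitz_onD[OF D xy] .
  finally show "dist (inverse ?a) (inverse ?b) \<le> A / c\<^sup>2 * dist x y"
    using c by (simp add: divide_right_mono)
qed (use lipschitz_on_nonneg[OF D] in simp)

text \<open>
  On the compact set \<open>\<Omega>\<close> each denominator has a positive lower bound \<open>c l\<close>. Replacing \<open>D l\<close> by
  \<open>max (c l) (D l)\<close> changes nothing on \<open>\<Omega>\<close> and gives a field that is Lipschitz on the convex hull of
  \<open>\<Omega>\<close>. Composition with the nearest-point projection onto the hull, which is 1-Lipschitz, makes it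
  global.
\<close>

lemma rational_field_lipschitz_extension:
  fixes f\<^sub>0 :: "real \<times> (real ^ 'n) \<Rightarrow> real ^ 'n"
  assumes poly_f0: "polynomial_function f\<^sub>0"
    and poly_N: "\<And>l. l \<in> {1..L} \<Longrightarrow> polynomial_function (N l)"
    and poly_D: "\<And>l. l \<in> {1..L} \<Longrightarrow> polynomial_function (D l)"
    and \<Omega>: "compact \<Omega>" "\<Omega> \<noteq> {}"
    and D_pos: "\<And>l z. l \<in> {1..L} \<Longrightarrow> z \<in> \<Omega> \<Longrightarrow> D l z > 0"
  obtains F K where "K-lipschitz_on UNIV F" "\<And>z. z \<in> \<Omega> \<Longrightarrow> F z = rational_field f\<^sub>0 L N D z"
proof -
  define Q where "Q = convex hull \<Omega>"
  have Q: "compact Q" "convex Q" "closed Q" "bounded Q" "\<Omega> \<subseteq> Q" "Q \<noteq> {}"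
    using \<Omega> by (auto simp: Q_def compact_convex_hull compact_imp_closed compact_imp_bounded
        hull_subset)
  have term_ext: "\<exists>c>0. (\<forall>z\<in>\<Omega>. c \<le> D l z) \<and> (\<exists>C. C-lipschitz_on Q (\<lambda>z. inverse (max c (D l z)) *\<^sub>R N l z))"
    if l: "l \<in> {1..L}" for l
  proof -
    obtain A where A: "A-lipschitz_on Q (D l)"
      using polynomial_function_lipschitz_on_bounded[OF Q(4) poly_D[OF l]] ..
    obtain B where B: "B-lipschitz_on Q (N l)"
      using polynomial_function_lipschitz_on_bounded[OF Q(4) poly_N[OF l]] ..
    have "continuous_on \<Omega> (D l)"
      using A Q by (meson continuous_on_subset lipschitz_on_continuous_on)
    then obtain z where z: "z \<in> \<Omega>" "\<forall>w\<in>\<Omega>. D l z \<le> D l w"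
      using continuous_attains_inf \<Omega> by blast
    have pos: "D l z > 0"
      using D_pos[OF l z(1)] .
    show ?thesis
      using pos z(2) lipschitz_on_scaleR_bounded[OF Q(4) lipschitz_on_inverse_max[OF pos A] B]
      by (intro exI[of _ "D l z"]) simp
  qed
  then obtain c where c: "\<And>l. l \<in> {1..L} \<Longrightarrow> c l > 0" "\<And>l z. l \<in> {1..L} \<Longrightarrow> z \<in> \<Omega> \<Longrightarrow> c l \<le> D l z"
    "\<And>l. l \<in> {1..L} \<Longrightarrow> \<exists>C. C-lipschitz_on Q (\<lambda>z. inverse (max (c l) (D l z)) *\<^sub>R N l z)"
    by (metis (no_types))
  define G where "G z = f\<^sub>0 z + (\<Sum>l=1..L. inverse (max (c l) (D l z)) *\<^sub>R N l z)" for z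
  obtain A where A: "A-lipschitz_on Q f\<^sub>0"
    using polynomial_function_lipschitz_on_bounded[OF Q(4) poly_f0] ..
  obtain B where "B-lipschitz_on Q (\<lambda>z. \<Sum>l=1..L. inverse (max (c l) (D l z)) *\<^sub>R N l z)"
    using lipschitz_on_sum[OF finite_atLeastAtMost c(3)] ..
  with A have G: "(A + B)-lipschitz_on Q G"
    unfolding G_def by (rule lipschitz_on_add)
  have "1-lipschitz_on UNIV (closest_point Q)"
    using Q by (auto intro!: lipschitz_onI closest_point_lipschitz)
  moreover have "closest_point Q ` UNIV \<subseteq> Q"
    using Q closest_point_in_set by blast
  ultimately have "((A + B) * 1)-lipschitz_on UNIV (\<lambda>z. G (closest_point Q z))"
    using G by (intro lipschitz_on_compose2[where g = G]) (auto intro: lipschitz_on_subset)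
  moreover have "G (closest_point Q z) = rational_field f\<^sub>0 L N D z" if "z \<in> \<Omega>" for z
  proof -
    have "closest_point Q z = z"
      using that Q by (auto intro: closest_point_self)
    then show ?thesis
      using c(2) that by (auto simp: G_def rational_field_def max_absorb2 intro!: sum.cong)
  qed
  ultimately show ?thesis
    using that by blast
qed

section \<open>Ordinary differential equations with Lipschitz right-hand side\<close>

text \<open>
  Global existence on an interval of any length, with the initial condition at any of its points, by
  one application of the Banach fixed point theorem. In the weighted norm
  \<open>sup \<parallel>y t\<parallel> / exp (\<kappa> \<bar>t - t\<^sub>1\<bar>)\<close> the Picard operator contracts by the factor \<open>K / \<kappa>\<close>, so no
  concatenation of short solutions is necessary.
\<close>

lemma lipschitz_ode_solution:
  fixes F :: "real \<times> 'a::banach \<Rightarrow> 'a"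
  assumes F: "K-lipschitz_on UNIV F" and t1: "t\<^sub>1 \<in> {a..b}"
  obtains y where "y t\<^sub>1 = x\<^sub>1"
    "\<And>t. t \<in> {a..b} \<Longrightarrow> (y has_vector_derivative F (t, y t)) (at t within {a..b})"
proof -
  define \<kappa> where "\<kappa> = 2 * K + 1"
  have K: "K \<ge> 0"
    using F by (rule lipschitz_on_nonneg)
  then have \<kappa>: "\<kappa> > 0" "K / \<kappa> \<le> 1/2"
    by (auto simp: \<kappa>_def field_simps)
  have F_cont: "continuous_on UNIV F"
    using F by (rule lipschitz_on_continuous_on)
  define E where "E t = exp (\<kappa> * \<bar>t - t\<^sub>1\<bar>)" for t
  have E_pos: "E t > 0" for t
    by (simp add: E_def)
  have E_cont: "continuous_on S E" for S
    unfolding E_def by (intro continuous_intros)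
  \<comment> \<open>The unknown is w = y / E, so that the weighted norm of y is the supremum norm of w.\<close>
  define g where "g w s = F (s, E s *\<^sub>R apply_bcontfun w s)" for w :: "real \<Rightarrow>\<^sub>C 'a" and s
  have g_cont: "continuous_on S (g w)" for w S
    unfolding g_def
    by (intro continuous_on_compose2[OF F_cont] continuous_intros E_cont) auto
  have g_int: "g w integrable_on {u..v}" for w u v
    using g_cont by (rule integrable_continuous_real)
  \<comment> \<open>The type of bounded continuous functions has domain UNIV; clamping the time extends a
    function on {a..b} constantly to both sides.\<close>
  define clamp where "clamp t = max a (min b t)" for t
  have clamp: "clamp t \<in> {a..b}" "t \<in> {a..b} \<Longrightarrow> clamp t = t" for t
    using t1 by (auto simp: clamp_def)
  have clamp_cont: "continuous_on UNIV clamp"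
    unfolding clamp_def by (intro continuous_intros)
  \<comment> \<open>The difference of two integrals from a is the oriented integral from t1 to t.\<close>
  define y where "y w t = x\<^sub>1 + (integral {a..t} (g w) - integral {a..t\<^sub>1} (g w))" for w t
  have y_cont: "continuous_on {a..b} (y w)" for w
    unfolding y_def by (intro continuous_intros indefinite_integral_continuous_1 g_int)
  define P where "P w t = inverse (E (clamp t)) *\<^sub>R y w (clamp t)" for w t
  have P_bcont: "P w \<in> bcontfun" for w
  proof -
    have cont: "continuous_on {a..b} (\<lambda>t. inverse (E t) *\<^sub>R y w t)"
      using E_pos by (intro continuous_intros y_cont E_cont) (simp add: less_imp_neq[symmetric])
    have "continuous_on UNIV (P w)"
      unfolding P_def using continuous_on_compose2[OF cont clamp_cont] clamp(1) by blast
    moreover have "bounded (range (P w))"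
    proof (rule bounded_subset)
      show "bounded ((\<lambda>t. inverse (E t) *\<^sub>R y w t) ` {a..b})"
        using cont by (intro compact_imp_bounded compact_continuous_image) auto
      show "range (P w) \<subseteq> (\<lambda>t. inverse (E t) *\<^sub>R y w t) ` {a..b}"
        using clamp(1) by (auto simp: P_def)
    qed
    ultimately show ?thesis
      by (simp add: bcontfun_def)
  qed
  define \<Phi> where "\<Phi> w = Bcontfun (P w)" for w
  have \<Phi>: "apply_bcontfun (\<Phi> w) = P w" for w
    using P_bcont by (simp add: \<Phi>_def Bcontfun_inverse)
  have contract: "dist (\<Phi> w) (\<Phi> w') \<le> 1/2 * dist w w'" for w w'
  proof (rule dist_bound)
    fix t0
    define t where "t = clamp t0"
    have t: "t \<in> {a..b}"
      using clamp by (simp add: t_def)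
    have g_diff: "norm (g w s - g w' s) \<le> K * dist w w' * E s" for s
    proof -
      have "norm (g w s - g w' s) \<le> K * dist (s, E s *\<^sub>R apply_bcontfun w s) (s, E s *\<^sub>R apply_bcontfun w' s)"
        unfolding g_def dist_norm[symmetric] by (rule lipschitz_onD[OF F]) auto
      also have "dist (s, E s *\<^sub>R apply_bcontfun w s) (s, E s *\<^sub>R apply_bcontfun w' s)
          = E s * dist (apply_bcontfun w s) (apply_bcontfun w' s)"
        using E_pos[of s] by (simp add: dist_Pair_Pair dist_norm flip: scaleR_diff_right)
      also have "K * (E s * dist (apply_bcontfun w s) (apply_bcontfun w' s)) \<le> K * (E s * dist w w')"
        using K E_pos[of s] by (intro mult_left_mono dist_bounded) auto
      finally show ?thesis by (simp add: mult_ac)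
    qed
    have y_diff: "norm (y w t - y w' t) \<le> K * dist w w' * (E t / \<kappa>)"
    proof (cases "t\<^sub>1 \<le> t")
      case True
      have split: "integral {a..t} (g u) = integral {a..t\<^sub>1} (g u) + integral {t\<^sub>1..t} (g u)" for u
        using Henstock_Kurzweil_Integration.integral_combine[OF _ True g_int, of a u] t1 by simp
      have prim: "((\<lambda>s. K * dist w w' * E s) has_integral
          (K * dist w w' * (E t / \<kappa>) - K * dist w w' * (E t\<^sub>1 / \<kappa>))) {t\<^sub>1..t}"
      proof (rule has_integral_eq[rotated])
        show "((\<lambda>s. K * dist w w' * exp (\<kappa> * (s - t\<^sub>1))) has_integral
          (K * dist w w' * (E t / \<kappa>) - K * dist w w' * (E t\<^sub>1 / \<kappa>))) {t\<^sub>1..t}"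
        proof -
          have "((\<lambda>s. K * dist w w' * (exp (\<kappa> * (s - t\<^sub>1)) / \<kappa>)) has_vector_derivative
              K * dist w w' * exp (\<kappa> * (s - t\<^sub>1))) (at s within {t\<^sub>1..t})" for s
            unfolding has_real_derivative_iff_has_vector_derivative[symmetric]
            using \<kappa>(1) by (auto intro!: derivative_eq_intros)
          from fundamental_theorem_of_calculus[OF True this] show ?thesis
            using True by (simp add: E_def)
        qed
      qed (auto simp: E_def)
      have "norm (y w t - y w' t) = norm (integral {t\<^sub>1..t} (\<lambda>s. g w s - g w' s))"
        by (simp add: y_def split Henstock_Kurzweil_Integration.integral_diff g_int)
      also have "\<dots> \<le> integral {t\<^sub>1..t} (\<lambda>s. K * dist w w' * E s)"
        using prim g_diff by (intro integral_norm_bound_integral) (auto intro: integrable_diff g_int)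
      also have "\<dots> \<le> K * dist w w' * (E t / \<kappa>)"
        using integral_unique[OF prim] K \<kappa> E_pos[of t\<^sub>1] by (simp add: less_imp_le)
      finally show ?thesis .
    next
      case False
      then have le: "t \<le> t\<^sub>1" by simp
      have split: "integral {a..t\<^sub>1} (g u) = integral {a..t} (g u) + integral {t..t\<^sub>1} (g u)" for u
        using Henstock_Kurzweil_Integration.integral_combine[OF _ le g_int, of a u] t by simp
      have prim: "((\<lambda>s. K * dist w w' * E s) has_integral
          (K * dist w w' * (- E t\<^sub>1 / \<kappa>) - K * dist w w' * (- E t / \<kappa>))) {t..t\<^sub>1}"
      proof (rule has_integral_eq[rotated])
        show "((\<lambda>s. K * dist w w' * exp (\<kappa> * (t\<^sub>1 - s))) has_integral
          (K * dist w w' * (- E t\<^sub>1 / \<kappa>) - K * dist w w' * (- E t / \<kappa>))) {t..t\<^sub>1}"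
        proof -
          have "((\<lambda>s. K * dist w w' * (- exp (\<kappa> * (t\<^sub>1 - s)) / \<kappa>)) has_vector_derivative
              K * dist w w' * exp (\<kappa> * (t\<^sub>1 - s))) (at s within {t..t\<^sub>1})" for s
            unfolding has_real_derivative_iff_has_vector_derivative[symmetric]
            using \<kappa>(1) by (auto intro!: derivative_eq_intros)
          from fundamental_theorem_of_calculus[OF le this] show ?thesis
            using le by (simp add: E_def)
        qed
      qed (auto simp: E_def)
      have "norm (y w t - y w' t) = norm (integral {t..t\<^sub>1} (\<lambda>s. g w s - g w' s))"
        by (simp add: y_def split Henstock_Kurzweil_Integration.integral_diff g_int norm_minus_commute)
      also have "\<dots> \<le> integral {t..t\<^sub>1} (\<lambda>s. K * dist w w' * E s)"
        using prim g_diff by (intro integral_norm_bound_integral) (auto intro: integrable_diff g_int)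
      also have "\<dots> \<le> K * dist w w' * (E t / \<kappa>)"
        using integral_unique[OF prim] K \<kappa> E_pos[of t\<^sub>1] by (simp add: less_imp_le)
      finally show ?thesis .
    qed
    have "dist (\<Phi> w t0) (\<Phi> w' t0) = inverse (E t) * norm (y w t - y w' t)"
      using E_pos[of t] by (simp add: \<Phi> P_def t_def dist_norm flip: scaleR_diff_right)
    also have "\<dots> \<le> inverse (E t) * (K * dist w w' * (E t / \<kappa>))"
      using E_pos[of t] y_diff by (intro mult_left_mono) auto
    also have "\<dots> = K / \<kappa> * dist w w'"
      using E_pos[of t] by simp
    also have "\<dots> \<le> 1/2 * dist w w'"
      using \<kappa> by (intro mult_right_mono) auto
    finally show "dist (\<Phi> w t0) (\<Phi> w' t0) \<le> 1/2 * dist w w'" .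
  qed
  obtain w where w: "\<Phi> w = w"
    using banach_fix_type[of "1/2" \<Phi>] contract by auto
  have fixed: "E t *\<^sub>R apply_bcontfun w t = y w t" if "t \<in> {a..b}" for t
  proof -
    have "apply_bcontfun w t = P w t"
      using \<Phi>[of w] w by simp
    then show ?thesis
      using E_pos[of t] clamp(2)[OF that] by (simp add: P_def)
  qed
  show ?thesis
  proof
    show "y w t\<^sub>1 = x\<^sub>1"
      by (simp add: y_def)
    fix t
    assume t: "t \<in> {a..b}"
    have "((\<lambda>t. integral {a..t} (g w)) has_vector_derivative g w t) (at t within {a..b})"
      using g_cont t by (rule integral_has_vector_derivative)
    then have "(y w has_vector_derivative g w t) (at t within {a..b})"
      unfolding y_def by (auto intro!: derivative_eq_intros)
    then show "(y w has_vector_derivative F (t, y w t)) (at t within {a..b})"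
      using fixed[OF t] by (simp add: g_def)
  qed
qed

lemma ode_solution_lipschitz:
  fixes F :: "real \<times> 'a::real_normed_vector \<Rightarrow> 'a"
  assumes F: "continuous_on UNIV F"
    and y: "\<And>t. t \<in> {c..d} \<Longrightarrow> (y has_vector_derivative F (t, y t)) (at t within {c..d})"
  shows "\<exists>C. C-lipschitz_on {c..d} y"
proof -
  have y_cont: "continuous_on {c..d} y"
    using y by (meson continuous_on_eq_continuous_within has_vector_derivative_continuous)
  have "continuous_on {c..d} (\<lambda>t. F (t, y t))"
    by (rule continuous_on_compose2[OF F]) (auto intro!: continuous_intros y_cont)
  then have "bounded ((\<lambda>t. F (t, y t)) ` {c..d})"
    by (intro compact_imp_bounded compact_continuous_image) auto
  then obtain C where C: "C > 0" "\<And>t. t \<in> {c..d} \<Longrightarrow> norm (F (t, y t)) \<le> C"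
    by (auto simp: bounded_pos)
  have "C-lipschitz_on {c..d} y"
  proof (rule bounded_derivative_imp_lipschitz)
    fix t
    assume t: "t \<in> {c..d}"
    show "(y has_derivative (\<lambda>h. h *\<^sub>R F (t, y t))) (at t within {c..d})"
      using y[OF t] by (simp add: has_vector_derivative_def)
    show "onorm (\<lambda>h. h *\<^sub>R F (t, y t)) \<le> C"
    proof (rule onorm_le)
      fix h :: real
      show "norm (h *\<^sub>R F (t, y t)) \<le> C * norm h"
        using mult_left_mono[OF C(2)[OF t], of "\<bar>h\<bar>"] by (simp add: mult.commute)
    qed
  qed (use C in auto)
  then show ?thesis ..
qed

section \<open>Pairing test functions with measures\<close>

text \<open>
  The Lie derivative is built from coordinatewise derivatives, which are partial evaluations of the
  total derivative wherever the latter exists.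
\<close>

lemma lie_deriv_eq_derivative:
  fixes v :: "real \<times> (real ^ 'n) \<Rightarrow> real"
  assumes v: "(v has_derivative v') (at z)"
  shows "time_deriv v z = v' (1, 0)" "w \<bullet> space_grad v z = v' (0, w)" "lie_deriv g v z = v' (1, g z)"
proof -
  obtain t x where z: "z = (t, x)" by (cases z)
  have lin: "linear v'"
    using v by (rule has_derivative_linear)
  have "((\<lambda>s. v (s, x)) has_derivative (\<lambda>s. v' (s, 0))) (at t)"
    using has_derivative_compose[OF has_derivative_Pair[OF has_derivative_ident has_derivative_const], of v v' t x] v
    by (simp add: z)
  moreover have "(\<lambda>s. v' (s, 0)) = (*) (v' (1, 0))"
  proof
    fix s
    show "v' (s, 0) = v' (1, 0) * s"
      using linear_cmul[OF lin, of s "(1, 0)"] by simp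
  qed
  ultimately have "((\<lambda>s. v (s, x)) has_field_derivative v' (1, 0)) (at t)"
    by (simp add: has_field_derivative_def)
  then show time: "time_deriv v z = v' (1, 0)"
    by (simp add: time_deriv_def z DERIV_imp_deriv)
  have v_space: "((\<lambda>y. v (t, y)) has_derivative (\<lambda>y. v' (0, y))) (at x)"
    using has_derivative_compose[OF has_derivative_Pair[OF has_derivative_const has_derivative_ident], of v v' t x] v
    by (simp add: z)
  then have fd: "frechet_derivative (\<lambda>y. v (t, y)) (at x) = (\<lambda>y. v' (0, y))"
    by (metis frechet_derivative_at)
  have space: "w \<bullet> space_grad v z = v' (0, w)" for w
  proof -
    have lin0: "linear (\<lambda>y. v' (0, y))"
      using v_space by (rule has_derivative_linear)
    have "v' (0, w) = v' (0, \<Sum>i\<in>UNIV. (w $ i) *\<^sub>R axis i 1)"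
      by (simp add: basis_expansion scalar_mult_eq_scaleR[symmetric])
    also have "\<dots> = (\<Sum>i\<in>UNIV. (w $ i) * v' (0, axis i 1))"
      using linear_sum[OF lin0, of "\<lambda>i. (w $ i) *\<^sub>R axis i 1" UNIV] linear_cmul[OF lin0] by simp
    also have "\<dots> = w \<bullet> space_grad v z"
      by (simp add: space_grad_def z fd inner_vec_def)
    finally show ?thesis by simp
  qed
  then show "w \<bullet> space_grad v z = v' (0, w)" .
  show "lie_deriv g v z = v' (1, g z)"
    using linear_add[OF lin, of "(1, 0)" "(0, g z)"] by (simp add: lie_deriv_def time space)
qed

lemma space_borel_measures_on: "\<mu> \<in> borel_measures_on S \<Longrightarrow> space \<mu> = S"
  using sets_eq_imp_space_eq[of \<mu> "restrict_space borel S"]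
  by (simp add: borel_measures_on_def space_restrict_space)

lemma integrable_continuous_borel_measures_on:
  fixes g :: "'a::{second_countable_topology, t2_space} \<Rightarrow> real"
  assumes \<mu>: "\<mu> \<in> borel_measures_on S" and S: "compact S" and g: "continuous_on S g"
  shows "integrable \<mu> g"
proof -
  have sets: "sets \<mu> = sets (restrict_space borel S)" and fin: "finite_measure \<mu>"
    using \<mu> by (auto simp: borel_measures_on_def)
  have space: "space \<mu> = S"
    using \<mu> by (rule space_borel_measures_on)
  have "g \<in> borel_measurable (restrict_space borel S)"
    using g by (rule borel_measurable_continuous_on_restrict)
  then have meas: "g \<in> borel_measurable \<mu>"
    using measurable_cong_sets[OF sets refl] by blast
  have "bounded (g ` S)"
    using S g by (intro compact_imp_bounded compact_continuous_image)
  then obtain B where "\<And>x. x \<in> S \<Longrightarrow> norm (g x) \<le> B"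
    by (auto simp: bounded_iff)
  then show ?thesis
    using meas space by (intro finite_measure.integrable_const_bound[OF fin, of _ B]) auto
qed

text \<open>
  Elimination of the \<open>\<nu> l\<close>: the relation between \<open>\<nu> l\<close> and \<open>\<mu>\<close>, tested with
  \<open>\<omega> = (N l \<bullet> \<nabla>v) / D l\<close>, replaces each integral over \<open>\<nu> l\<close> by one over \<open>\<mu>\<close>. The sum is the derivative
  of \<open>v\<close> along the rational field. Both inequalities of the final theorem use this identity.
\<close>

lemma lie_deriv_rational_field_pairing:
  fixes f\<^sub>0 :: "real \<times> (real ^ 'n) \<Rightarrow> real ^ 'n" and v :: "real \<times> (real ^ 'n) \<Rightarrow> real"
  assumes \<Omega>: "compact \<Omega>"
    and \<mu>: "\<mu> \<in> borel_measures_on \<Omega>"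
    and \<nu>: "\<And>l. l \<in> {1..L} \<Longrightarrow> \<nu> l \<in> borel_measures_on \<Omega>"
    and \<nu>_\<mu>: "\<And>l \<omega>. l \<in> {1..L} \<Longrightarrow> continuous_on \<Omega> \<omega> \<Longrightarrow> (\<integral>z. \<omega> z * D l z \<partial>\<nu> l) = (\<integral>z. \<omega> z \<partial>\<mu>)"
    and f0: "continuous_on \<Omega> f\<^sub>0"
    and N: "\<And>l. l \<in> {1..L} \<Longrightarrow> continuous_on \<Omega> (N l)"
    and D: "\<And>l. l \<in> {1..L} \<Longrightarrow> continuous_on \<Omega> (D l)"
    and D_pos: "\<And>l z. l \<in> {1..L} \<Longrightarrow> z \<in> \<Omega> \<Longrightarrow> D l z > 0"
    and v'_cont: "continuous_on \<Omega> v'"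
    and v': "\<And>z. z \<in> \<Omega> \<Longrightarrow> (v has_derivative blinfun_apply (v' z)) (at z)"
  shows "(\<integral>z. lie_deriv f\<^sub>0 v z \<partial>\<mu>) + (\<Sum>l=1..L. \<integral>z. N l z \<bullet> space_grad v z \<partial>\<nu> l)
    = (\<integral>z. v' z (1, rational_field f\<^sub>0 L N D z) \<partial>\<mu>)"
proof -
  have space: "space \<mu> = \<Omega>" "\<And>l. l \<in> {1..L} \<Longrightarrow> space (\<nu> l) = \<Omega>"
    using \<mu> \<nu> by (simp_all add: space_borel_measures_on)
  note cont = v'_cont f0 N D
  have int0: "integrable \<mu> (\<lambda>z. v' z (1, f\<^sub>0 z))"
    by (intro integrable_continuous_borel_measures_on[OF \<mu> \<Omega>] continuous_intros cont)
  have int: "integrable \<mu> (\<lambda>z. v' z (0, N l z /\<^sub>R D l z))" if "l \<in> {1..L}" for l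
    using that D_pos
    by (intro integrable_continuous_borel_measures_on[OF \<mu> \<Omega>] continuous_intros cont)
       force+
  have int_sum: "integrable \<mu> (\<lambda>z. \<Sum>l=1..L. v' z (0, N l z /\<^sub>R D l z))"
    using int by (rule Bochner_Integration.integrable_sum)
  have lie: "(\<integral>z. lie_deriv f\<^sub>0 v z \<partial>\<mu>) = (\<integral>z. v' z (1, f\<^sub>0 z) \<partial>\<mu>)"
    by (intro Bochner_Integration.integral_cong refl lie_deriv_eq_derivative(3) v') (simp add: space)
  have rational: "(\<Sum>l=1..L. \<integral>z. N l z \<bullet> space_grad v z \<partial>\<nu> l) = (\<Sum>l=1..L. \<integral>z. v' z (0, N l z /\<^sub>R D l z) \<partial>\<mu>)"
  proof (rule sum.cong[OF refl])
    fix l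
    assume l: "l \<in> {1..L}"
    have "(\<integral>z. N l z \<bullet> space_grad v z \<partial>\<nu> l) = (\<integral>z. v' z (0, N l z /\<^sub>R D l z) * D l z \<partial>\<nu> l)"
    proof (rule Bochner_Integration.integral_cong[OF refl])
      fix z
      assume "z \<in> space (\<nu> l)"
      then have z: "z \<in> \<Omega>"
        using space l by simp
      have pos: "D l z > 0"
        using D_pos[OF l] z by simp
      have "N l z \<bullet> space_grad v z = v' z (0, N l z)"
        using v'[OF z] by (rule lie_deriv_eq_derivative(2))
      also have "(0, N l z) = D l z *\<^sub>R (0, N l z /\<^sub>R D l z)"
        using pos by simp
      also have "v' z (D l z *\<^sub>R (0, N l z /\<^sub>R D l z)) = D l z * v' z (0, N l z /\<^sub>R D l z)"
        by (simp only: blinfun.scaleR_right real_scaleR_def)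
      finally show "N l z \<bullet> space_grad v z = v' z (0, N l z /\<^sub>R D l z) * D l z"
        by simp
    qed
    also have "\<dots> = (\<integral>z. v' z (0, N l z /\<^sub>R D l z) \<partial>\<mu>)"
    proof -
      have "continuous_on \<Omega> (\<lambda>z. v' z (0, N l z /\<^sub>R D l z))"
        using l D_pos by (intro continuous_intros cont) force+
      then show ?thesis
        using \<nu>_\<mu>[OF l] by simp
    qed
    finally show "(\<integral>z. N l z \<bullet> space_grad v z \<partial>\<nu> l) = (\<integral>z. v' z (0, N l z /\<^sub>R D l z) \<partial>\<mu>)" .
  qed
  have "(\<integral>z. v' z (1, rational_field f\<^sub>0 L N D z) \<partial>\<mu>)
      = (\<integral>z. v' z (1, f\<^sub>0 z) + (\<Sum>l=1..L. v' z (0, N l z /\<^sub>R D l z)) \<partial>\<mu>)"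
    by (simp add: rational_field_def sum_prod flip: blinfun.sum_right blinfun.add_right)
  also have "\<dots> = (\<integral>z. v' z (1, f\<^sub>0 z) \<partial>\<mu>) + (\<integral>z. (\<Sum>l=1..L. v' z (0, N l z /\<^sub>R D l z)) \<partial>\<mu>)"
    by (rule Bochner_Integration.integral_add[OF int0 int_sum])
  also have "(\<integral>z. (\<Sum>l=1..L. v' z (0, N l z /\<^sub>R D l z)) \<partial>\<mu>) = (\<Sum>l=1..L. \<integral>z. v' z (0, N l z /\<^sub>R D l z) \<partial>\<mu>)"
    using int by (rule Bochner_Integration.integral_sum)
  finally show ?thesis
    by (simp only: lie rational)
qed

section \<open>Test functions supported in tubes around solutions\<close>

text \<open>
  Squaring the positive part gives a nonnegative \<open>C\<^sup>1\<close> cutoff, with no case distinction in the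
  derivative.
\<close>

lemma has_real_derivative_positive_part_square:
  "((\<lambda>r::real. (max 0 r)\<^sup>2) has_real_derivative 2 * max 0 r) (at r)"
proof -
  consider "r < 0" | "r = 0" | "r > 0" by linarith
  then show ?thesis
  proof cases
    case 1
    have "((\<lambda>r::real. 0) has_real_derivative 2 * max 0 r) (at r)"
      using 1 by simp
    then show ?thesis
      by (rule has_field_derivative_transform_within_open[where S = "{..<0}"]) (use 1 in auto)
  next
    case 2
    have "(\<lambda>h::real. (max 0 h)\<^sup>2 / h) \<midarrow>0\<rightarrow> 0"
    proof (rule Lim_null_comparison)
      show "\<forall>\<^sub>F h in at 0. norm ((max 0 h)\<^sup>2 / h) \<le> \<bar>h::real\<bar>"
        by (auto simp: max_def power2_eq_square)
      show "(\<lambda>h::real. \<bar>h\<bar>) \<midarrow>0\<rightarrow> 0"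
        by (auto intro!: tendsto_eq_intros)
    qed
    then show ?thesis
      by (simp add: DERIV_def 2)
  next
    case 3
    have "((\<lambda>r::real. r\<^sup>2) has_real_derivative 2 * max 0 r) (at r)"
      using 3 by (auto intro!: derivative_eq_intros)
    then show ?thesis
      by (rule has_field_derivative_transform_within_open[where S = "{0<..}"]) (use 3 in auto)
  qed
qed

text \<open>
  The tube is the region where this function is positive: a neighbourhood of the graph of \<open>y\<close> of radius
  \<open>\<epsilon> exp (- c t / 2)\<close>, additionally closed off for times before \<open>\<sigma>\<close> by the term with factor \<open>A\<close>. The term
  vanishes after \<open>\<sigma>\<close>.
\<close>

definition tube :: "(real \<Rightarrow> 'a::euclidean_space) \<Rightarrow> real \<Rightarrow> real \<Rightarrow> real \<Rightarrow> real \<Rightarrow> real \<times> 'a \<Rightarrow> real"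
  where "tube y c \<epsilon> A \<sigma> z =
    \<epsilon>\<^sup>2 - exp (c * fst z) * (norm (snd z - y (fst z)))\<^sup>2 - A * (max 0 (\<sigma> - fst z))\<^sup>2"

lemma has_derivative_tube:
  fixes y :: "real \<Rightarrow> 'a::euclidean_space"
  assumes y: "(y has_vector_derivative F (t, y t)) (at t)"
  shows "(tube y c \<epsilon> A \<sigma> has_derivative (\<lambda>h.
      - exp (c * t) * (c * fst h * (norm (x - y t))\<^sup>2 + 2 * ((x - y t) \<bullet> (snd h - fst h *\<^sub>R F (t, y t))))
      + 2 * A * max 0 (\<sigma> - t) * fst h)) (at (t, x))"
proof -
  define r where "r z = snd z - y (fst z)" for z :: "real \<times> 'a"
  have y_fst: "((\<lambda>z::real \<times> 'a. y (fst z)) has_derivative (\<lambda>h. fst h *\<^sub>R F (t, y t))) (at (t, x))"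
    using has_derivative_compose[OF has_derivative_fst[OF has_derivative_ident], of y "\<lambda>s. s *\<^sub>R F (t, y t)" "(t, x)" UNIV] y
    by (simp add: has_vector_derivative_def)
  have r: "(r has_derivative (\<lambda>h. snd h - fst h *\<^sub>R F (t, y t))) (at (t, x))"
    unfolding r_def[abs_def]
    by (intro has_derivative_diff has_derivative_snd has_derivative_ident y_fst)
  have E: "((\<lambda>z::real \<times> 'a. exp (c * fst z)) has_derivative (\<lambda>h. exp (c * t) * (c * fst h))) (at (t, x))"
    using has_derivative_compose[OF has_derivative_mult_right[OF has_derivative_fst[OF has_derivative_ident]],
        of exp "(*) (exp (c * t))" c "(t, x)" UNIV] DERIV_exp[of "c * t"]
    by (simp add: has_field_derivative_def)
  have pp: "((\<lambda>z::real \<times> 'a. (max 0 (\<sigma> - fst z))\<^sup>2) has_derivative (\<lambda>h. 2 * max 0 (\<sigma> - t) * (0 - fst h))) (at (t, x))"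
    using has_derivative_compose[OF has_derivative_diff[OF has_derivative_const has_derivative_fst[OF has_derivative_ident]],
        of "\<lambda>r. (max 0 r)\<^sup>2" "(*) (2 * max 0 (\<sigma> - t))" \<sigma> "(t, x)" UNIV]
      has_real_derivative_positive_part_square[of "\<sigma> - t"]
    by (simp add: has_field_derivative_def)
  have der: "((\<lambda>z. \<epsilon>\<^sup>2 - exp (c * fst z) * (r z \<bullet> r z) - A * (max 0 (\<sigma> - fst z))\<^sup>2) has_derivative (\<lambda>h. 0 -
      (exp (c * fst (t, x)) * (r (t, x) \<bullet> (snd h - fst h *\<^sub>R F (t, y t)) + (snd h - fst h *\<^sub>R F (t, y t)) \<bullet> r (t, x))
        + exp (c * t) * (c * fst h) * (r (t, x) \<bullet> r (t, x)))
      - A * (2 * max 0 (\<sigma> - t) * (0 - fst h)))) (at (t, x))"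
    by (intro has_derivative_diff has_derivative_const has_derivative_mult[OF E has_derivative_inner[OF r r]]
        has_derivative_mult_right pp)
  have rearrange: "(\<lambda>h. 0 -
      (exp (c * fst (t, x)) * (r (t, x) \<bullet> (snd h - fst h *\<^sub>R F (t, y t)) + (snd h - fst h *\<^sub>R F (t, y t)) \<bullet> r (t, x))
        + exp (c * t) * (c * fst h) * (r (t, x) \<bullet> r (t, x)))
      - A * (2 * max 0 (\<sigma> - t) * (0 - fst h)))
      = (\<lambda>h. - exp (c * t) * (c * fst h * (norm (x - y t))\<^sup>2 + 2 * ((x - y t) \<bullet> (snd h - fst h *\<^sub>R F (t, y t))))
      + 2 * A * max 0 (\<sigma> - t) * fst h)"
  proof
    fix h :: "real \<times> 'a"
    define w where "w = snd h - fst h *\<^sub>R F (t, y t)"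
    define \<rho> where "\<rho> = x - y t"
    have \<rho>: "r (t, x) = \<rho>"
      by (simp add: r_def \<rho>_def)
    show "0 -
      (exp (c * fst (t, x)) * (r (t, x) \<bullet> (snd h - fst h *\<^sub>R F (t, y t)) + (snd h - fst h *\<^sub>R F (t, y t)) \<bullet> r (t, x))
        + exp (c * t) * (c * fst h) * (r (t, x) \<bullet> r (t, x)))
      - A * (2 * max 0 (\<sigma> - t) * (0 - fst h))
      = - exp (c * t) * (c * fst h * (norm (x - y t))\<^sup>2 + 2 * ((x - y t) \<bullet> (snd h - fst h *\<^sub>R F (t, y t))))
      + 2 * A * max 0 (\<sigma> - t) * fst h"
      unfolding w_def[symmetric] \<rho>_def[symmetric] \<rho> power2_norm_eq_inner inner_commute[of w \<rho>] fst_conv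
      by algebra
  qed
  have tube: "tube y c \<epsilon> A \<sigma> = (\<lambda>z. \<epsilon>\<^sup>2 - exp (c * fst z) * (r z \<bullet> r z) - A * (max 0 (\<sigma> - fst z))\<^sup>2)"
    by (simp add: fun_eq_iff tube_def power2_norm_eq_inner r_def)
  show ?thesis
    unfolding tube using der rearrange by (rule has_derivative_eq_rhs)
qed

text \<open>
  The one-sided Lipschitz estimate: two solutions separate or approach at most exponentially with rate
  \<open>K\<close>, so that \<open>exp (2 K t) \<parallel>x - y\<parallel>\<^sup>2\<close> increases along the flow.
\<close>

lemma lipschitz_tube_derivative_nonneg:
  fixes F :: "real \<times> 'a::real_inner \<Rightarrow> 'a"
  assumes F: "K-lipschitz_on UNIV F"
  shows "2 * K * (norm (x - y))\<^sup>2 + 2 * ((x - y) \<bullet> (F (t, x) - F (t, y))) \<ge> 0"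
proof -
  have "\<bar>(x - y) \<bullet> (F (t, x) - F (t, y))\<bar> \<le> norm (x - y) * norm (F (t, x) - F (t, y))"
    by (rule Cauchy_Schwarz_ineq2)
  also have "\<dots> \<le> norm (x - y) * (K * norm (x - y))"
    using lipschitz_onD[OF F, of "(t, x)" "(t, y)"]
    by (intro mult_left_mono) (auto simp: dist_Pair_Pair dist_norm)
  finally show ?thesis
    by (simp add: power2_eq_square abs_le_iff algebra_simps)
qed

text \<open>
  The test function is \<open>v = (max 0 q)\<^sup>2\<close> with \<open>q\<close> the tube function of rate \<open>c = 2 K\<close>. Inside the tube,
  \<open>cutoff\<close> forces \<open>t \<ge> \<sigma>\<close>; there the closing term is inactive and the previous estimate makes \<open>v\<close> decrease
  along \<open>f\<close>. By \<open>initial\<close>, \<open>v\<close> contributes nothing at time 0. So \<open>\<integral>v d\<mu>\<^sub>p \<le> 0\<close>, and \<open>v\<close> vanishes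
  \<open>\<mu>\<^sub>p\<close>-almost everywhere. The solution \<open>y\<close> is given on a larger interval than \<open>{0..T}\<close> because \<open>v\<close> must be
  \<open>C\<^sup>1\<close> on an open neighbourhood.
\<close>

lemma feasible_tube_null:
  fixes f\<^sub>0 :: "real \<times> (real ^ 'n) \<Rightarrow> real ^ 'n"
  assumes feas: "feasible_sum_of_rational f\<^sub>0 L N D T X\<^sub>0 X \<mu>\<^sub>0 \<mu> \<mu>\<^sub>p \<nu>"
    and X: "compact X"
    and f0: "continuous_on ({0..T} \<times> X) f\<^sub>0"
    and N: "\<And>l. l \<in> {1..L} \<Longrightarrow> continuous_on ({0..T} \<times> X) (N l)"
    and D: "\<And>l. l \<in> {1..L} \<Longrightarrow> continuous_on ({0..T} \<times> X) (D l)"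
    and D_pos: "\<And>l z. l \<in> {1..L} \<Longrightarrow> z \<in> {0..T} \<times> X \<Longrightarrow> D l z > 0"
    and F: "K-lipschitz_on UNIV F"
    and F_eq: "\<And>z. z \<in> {0..T} \<times> X \<Longrightarrow> F z = rational_field f\<^sub>0 L N D z"
    and ab: "a < 0" "T < b"
    and y: "\<And>t. t \<in> {a..b} \<Longrightarrow> (y has_vector_derivative F (t, y t)) (at t within {a..b})"
    and cutoff: "\<And>z. z \<in> {0..T} \<times> X \<Longrightarrow> fst z < \<sigma> \<Longrightarrow> tube y (2 * K) \<epsilon> A \<sigma> z \<le> 0"
    and initial: "\<And>x. x \<in> X\<^sub>0 \<Longrightarrow> tube y (2 * K) \<epsilon> A \<sigma> (0, x) \<le> 0"
  shows "AE z in \<mu>\<^sub>p. tube y (2 * K) \<epsilon> A \<sigma> z \<le> 0"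
    and "continuous_on ({0..T} \<times> X) (tube y (2 * K) \<epsilon> A \<sigma>)"
proof -
  define \<Omega> where "\<Omega> = {0..T} \<times> X"
  have \<Omega>: "compact \<Omega>"
    using X by (simp add: \<Omega>_def compact_Times)
  have \<mu>0: "\<mu>\<^sub>0 \<in> borel_measures_on X\<^sub>0" and \<mu>: "\<mu> \<in> borel_measures_on \<Omega>" and \<mu>p: "\<mu>\<^sub>p \<in> borel_measures_on \<Omega>"
    using feas by (auto simp: feasible_sum_of_rational_def \<Omega>_def)
  define q where "q = tube y (2 * K) \<epsilon> A \<sigma>"
  define U where "U = {a<..<b} \<times> (UNIV :: (real ^ 'n) set)"
  have U: "open U" "\<Omega> \<subseteq> U"
    using ab by (auto simp: U_def \<Omega>_def open_Times)
  define q' where "q' z h = - exp (2 * K * fst z) * (2 * K * fst h * (norm (snd z - y (fst z)))\<^sup>2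
      + 2 * ((snd z - y (fst z)) \<bullet> (snd h - fst h *\<^sub>R F (fst z, y (fst z)))))
      + 2 * A * max 0 (\<sigma> - fst z) * fst h" for z h :: "real \<times> (real ^ 'n)"
  have q': "(q has_derivative q' z) (at z)" if "z \<in> U" for z
  proof -
    have t: "fst z \<in> {a<..<b}"
      using that by (auto simp: U_def)
    then have "(y has_vector_derivative F (fst z, y (fst z))) (at (fst z) within {a..b})"
      by (intro y) auto
    moreover have "at (fst z) within {a..b} = at (fst z)"
      using t by (intro at_within_interior) (simp add: interior_atLeastAtMost_real)
    ultimately show ?thesis
      using has_derivative_tube[of y F "fst z" "2 * K" \<epsilon> A \<sigma> "snd z"]
      by (simp add: q_def q'_def[abs_def])
  qed
  define v where "v z = (max 0 (q z))\<^sup>2" for z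
  define v' where "v' z = (2 * max 0 (q z)) *\<^sub>R Blinfun (q' z)" for z
  have Blinfun_q': "blinfun_apply (Blinfun (q' z)) = q' z" if "z \<in> U" for z
    using q'[OF that] by (intro bounded_linear_Blinfun_apply has_derivative_bounded_linear)
  have v'_apply: "blinfun_apply (v' z) h = 2 * max 0 (q z) * q' z h" if "z \<in> U" for z h
    using Blinfun_q'[OF that] by (simp add: v'_def scaleR_blinfun.rep_eq)
  have v_deriv: "(v has_derivative blinfun_apply (v' z)) (at z)" if "z \<in> U" for z
  proof -
    have "((\<lambda>r::real. (max 0 r)\<^sup>2) has_derivative (*) (2 * max 0 (q z))) (at (q z))"
      using has_real_derivative_positive_part_square by (simp add: has_field_derivative_def)
    then have "(v has_derivative (\<lambda>h. 2 * max 0 (q z) * q' z h)) (at z)"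
      using has_derivative_compose[OF q'[OF that], of "\<lambda>r. (max 0 r)\<^sup>2" "(*) (2 * max 0 (q z))"]
      by (simp add: v_def[abs_def])
    moreover have "(\<lambda>h. 2 * max 0 (q z) * q' z h) = blinfun_apply (v' z)"
      using v'_apply[OF that] by (simp add: fun_eq_iff)
    ultimately show ?thesis
      by (rule has_derivative_eq_rhs)
  qed
  have q_cont: "continuous_on U q"
    using q' by (meson continuous_at_imp_continuous_on has_derivative_continuous)
  have v'_cont: "continuous_on U v'"
  proof -
    have "continuous_on {a..b} y"
      using y by (meson continuous_on_eq_continuous_within has_vector_derivative_continuous)
    then have y_cont: "continuous_on U (\<lambda>z. y (fst z))"
      by (rule continuous_on_compose2) (auto simp: U_def intro!: continuous_intros)
    have F_cont: "continuous_on U (\<lambda>z. F (fst z, y (fst z)))"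
      by (rule continuous_on_compose2[OF lipschitz_on_continuous_on[OF F]])
         (auto intro!: continuous_intros y_cont)
    have "continuous_on U (\<lambda>z. Blinfun (q' z))"
    proof (rule continuous_on_blinfun_componentwise)
      fix i :: "real \<times> (real ^ 'n)"
      have "continuous_on U (\<lambda>z. q' z i)"
        unfolding q'_def by (intro continuous_intros y_cont F_cont)
      then show "continuous_on U (\<lambda>z. blinfun_apply (Blinfun (q' z)) i)"
        by (rule continuous_on_eq) (simp add: Blinfun_q')
    qed
    then show ?thesis
      unfolding v'_def by (intro continuous_intros q_cont)
  qed
  have "(\<integral>z. v z \<partial>\<mu>\<^sub>p) = (\<integral>x. v (0, x) \<partial>\<mu>\<^sub>0) + (\<integral>z. v' z (1, rational_field f\<^sub>0 L N D z) \<partial>\<mu>)"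
  proof -
    have "C1_on_nbhd \<Omega> v"
      using U v'_cont v_deriv unfolding C1_on_nbhd_def by blast
    then have "(\<integral>z. v z \<partial>\<mu>\<^sub>p) = (\<integral>x. v (0, x) \<partial>\<mu>\<^sub>0) + ((\<integral>z. lie_deriv f\<^sub>0 v z \<partial>\<mu>)
        + (\<Sum>l=1..L. \<integral>z. N l z \<bullet> space_grad v z \<partial>\<nu> l))"
      using feas by (simp add: feasible_sum_of_rational_def \<Omega>_def)
    also have "(\<integral>z. lie_deriv f\<^sub>0 v z \<partial>\<mu>) + (\<Sum>l=1..L. \<integral>z. N l z \<bullet> space_grad v z \<partial>\<nu> l)
        = (\<integral>z. v' z (1, rational_field f\<^sub>0 L N D z) \<partial>\<mu>)"
    proof (rule lie_deriv_rational_field_pairing[OF \<Omega> \<mu>])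
      show "\<nu> l \<in> borel_measures_on \<Omega>"
        "continuous_on \<Omega> \<omega> \<Longrightarrow> (\<integral>z. \<omega> z * D l z \<partial>\<nu> l) = (\<integral>z. \<omega> z \<partial>\<mu>)" if "l \<in> {1..L}" for l \<omega>
        using feas that by (auto simp: feasible_sum_of_rational_def \<Omega>_def)
      show "continuous_on \<Omega> v'"
        using v'_cont U(2) by (rule continuous_on_subset)
      show "(v has_derivative blinfun_apply (v' z)) (at z)" if "z \<in> \<Omega>" for z
        using v_deriv U(2) that by blast
    qed (use f0 N D D_pos in \<open>auto simp: \<Omega>_def\<close>)
    finally show ?thesis .
  qed
  moreover have "(\<integral>x. v (0, x) \<partial>\<mu>\<^sub>0) = (\<integral>x. 0 \<partial>\<mu>\<^sub>0)"
    using initial space_borel_measures_on[OF \<mu>0]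
    by (intro Bochner_Integration.integral_cong refl) (simp add: v_def q_def max_absorb1)
  moreover have "(\<integral>z. - v' z (1, rational_field f\<^sub>0 L N D z) \<partial>\<mu>) \<ge> 0"
  proof (rule Bochner_Integration.integral_nonneg)
    fix z
    assume "z \<in> space \<mu>"
    then have z: "z \<in> \<Omega>"
      using space_borel_measures_on[OF \<mu>] by simp
    obtain t x where tx: "z = (t, x)" by (cases z)
    have "max 0 (q z) * q' z (1, F z) \<le> 0"
    proof (cases "q z \<le> 0")
      case False
      then have "\<sigma> \<le> t"
        using cutoff[of z] z by (cases "t < \<sigma>") (auto simp: q_def \<Omega>_def tx)
      then have "q' z (1, F z) = - exp (2 * K * t) * (2 * K * (norm (x - y t))\<^sup>2
          + 2 * ((x - y t) \<bullet> (F (t, x) - F (t, y t))))"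
        by (simp add: q'_def tx)
      also have "\<dots> \<le> 0"
        using lipschitz_tube_derivative_nonneg[OF F] by simp
      finally show ?thesis
        by (simp add: mult_nonneg_nonpos)
    qed (simp add: max_absorb1)
    then show "0 \<le> - v' z (1, rational_field f\<^sub>0 L N D z)"
      using v'_apply[of z] z U F_eq[of z] by (auto simp: \<Omega>_def)
  qed
  ultimately have le: "(\<integral>z. v z \<partial>\<mu>\<^sub>p) \<le> 0"
    by simp
  have q_cont_\<Omega>: "continuous_on \<Omega> q"
    using q_cont U(2) by (rule continuous_on_subset)
  then have "continuous_on \<Omega> v"
    unfolding v_def by (intro continuous_intros)
  then have int: "integrable \<mu>\<^sub>p v"
    by (rule integrable_continuous_borel_measures_on[OF \<mu>p \<Omega>])
  have nonneg: "AE z in \<mu>\<^sub>p. 0 \<le> v z"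
    by (simp add: v_def)
  have "(\<integral>z. v z \<partial>\<mu>\<^sub>p) = 0"
    using le integral_nonneg_AE[OF nonneg] by simp
  then have "AE z in \<mu>\<^sub>p. v z = 0"
    using integral_nonneg_eq_0_iff_AE[OF int nonneg] by simp
  then show "AE z in \<mu>\<^sub>p. tube y (2 * K) \<epsilon> A \<sigma> z \<le> 0"
    by eventually_elim (simp add: v_def q_def max_def split: if_splits)
  show "continuous_on ({0..T} \<times> X) (tube y (2 * K) \<epsilon> A \<sigma>)"
    using q_cont_\<Omega> by (simp add: q_def \<Omega>_def)
qed

section \<open>Feasible terminal measures live on the reachable set\<close>

definition reachable_set ::
  "(real \<times> (real ^ 'n) \<Rightarrow> real ^ 'n) \<Rightarrow> nat \<Rightarrow> (nat \<Rightarrow> real \<times> (real ^ 'n) \<Rightarrow> real ^ 'n) \<Rightarrow>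
   (nat \<Rightarrow> real \<times> (real ^ 'n) \<Rightarrow> real) \<Rightarrow> real \<Rightarrow> (real ^ 'n) set \<Rightarrow> (real ^ 'n) set \<Rightarrow>
   (real \<times> (real ^ 'n)) set"
  where "reachable_set f\<^sub>0 L N D T X\<^sub>0 X =
    {(t, y t) | t y x\<^sub>0. t \<in> {0..T} \<and> x\<^sub>0 \<in> X\<^sub>0 \<and> is_trajectory f\<^sub>0 L N D x\<^sub>0 t y \<and> (\<forall>s\<in>{0..t}. y s \<in> X)}"

lemma peak_value_eq_reachable_set:
  "peak_value f\<^sub>0 L N D T X\<^sub>0 X p = (SUP z\<in>reachable_set f\<^sub>0 L N D T X\<^sub>0 X. ereal (p (snd z)))"
  unfolding peak_value_def reachable_set_def by (rule arg_cong[of _ _ Sup]) force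

lemma ode_solution_is_trajectory:
  fixes f\<^sub>0 :: "real \<times> (real ^ 'n) \<Rightarrow> real ^ 'n"
  assumes F: "continuous_on UNIV F"
    and y: "\<And>s. s \<in> {0..t} \<Longrightarrow> (y has_vector_derivative F (s, y s)) (at s within {0..t})"
    and F_eq: "\<And>s. s \<in> {0..t} \<Longrightarrow> F (s, y s) = rational_field f\<^sub>0 L N D (s, y s)"
    and D: "\<And>l s. l \<in> {1..L} \<Longrightarrow> s \<in> {0..t} \<Longrightarrow> D l (s, y s) \<noteq> 0"
  shows "is_trajectory f\<^sub>0 L N D (y 0) t y"
proof -
  obtain C where "C-lipschitz_on {0..t} y"
    using ode_solution_lipschitz[OF F y] by blast
  then have "absolutely_continuous_curve 0 t y"
    by (rule lipschitz_imp_absolutely_continuous_curve)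
  moreover have "AE s in lborel. s \<in> {0..t} \<longrightarrow>
       (\<forall>l\<in>{1..L}. D l (s, y s) \<noteq> 0) \<and>
       (y has_vector_derivative rational_field f\<^sub>0 L N D (s, y s)) (at s within {0..t})"
    using y F_eq D by (intro AE_I2) auto
  ultimately show ?thesis
    by (simp add: is_trajectory_def)
qed

text \<open>
  If \<open>y\<close> is outside \<open>X\<close> at time \<open>s\<close>, it keeps a positive distance to \<open>X\<close> during a short time interval
  from \<open>s\<close> to \<open>\<sigma>\<close>. A tube narrower than this distance does not meet \<open>X\<close> during that interval, and
  \<open>A\<close> is chosen so large that the tube is empty before \<open>s\<close>.
\<close>

lemma exit_tube:
  fixes y :: "real \<Rightarrow> 'a::euclidean_space"
  assumes X: "closed X" and y: "continuous_on {a..b} y"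
    and s: "a \<le> s" "s < t\<^sub>1" "t\<^sub>1 \<le> b" "y s \<notin> X" and c: "c \<ge> 0"
  obtains \<epsilon> A \<sigma> where "s < \<sigma>" "\<sigma> \<le> t\<^sub>1" "\<epsilon> > 0"
    "\<And>t x. 0 \<le> t \<Longrightarrow> t < \<sigma> \<Longrightarrow> x \<in> X \<Longrightarrow> tube y c \<epsilon> A \<sigma> (t, x) \<le> 0"
proof -
  have "\<exists>r>0. ball (y s) r \<subseteq> - X"
    using open_contains_ball_eq[of "- X"] X s(4) by (simp add: open_Compl)
  then obtain r where r: "r > 0" "ball (y s) r \<inter> X = {}"
    by blast
  obtain d where d: "d > 0" "\<And>t. t \<in> {a..b} \<Longrightarrow> dist t s < d \<Longrightarrow> dist (y t) (y s) < r / 2"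
  proof -
    have "s \<in> {a..b}"
      using s by simp
    then have "\<exists>d>0. \<forall>t\<in>{a..b}. dist t s < d \<longrightarrow> dist (y t) (y s) < r / 2"
      using y half_gt_zero[OF r(1)] unfolding continuous_on_iff by blast
    then show thesis
      using that by blast
  qed
  define \<delta> where "\<delta> = min d (t\<^sub>1 - s)"
  have \<delta>: "\<delta> > 0" "\<delta> \<le> d" "s + \<delta> \<le> t\<^sub>1"
    using d(1) s(2) by (auto simp: \<delta>_def)
  define \<epsilon> where "\<epsilon> = r / 2"
  define A where "A = \<epsilon>\<^sup>2 / \<delta>\<^sup>2"
  show ?thesis
  proof
    show "s < s + \<delta>" "s + \<delta> \<le> t\<^sub>1" "\<epsilon> > 0"
      using \<delta> r by (auto simp: \<epsilon>_def)
    fix t x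
    assume t: "0 \<le> t" "t < s + \<delta>" and x: "x \<in> X"
    have A: "A \<ge> 0"
      by (simp add: A_def)
    show "tube y c \<epsilon> A (s + \<delta>) (t, x) \<le> 0"
    proof (cases "s \<le> t")
      case True
      have "dist (y t) (y s) < r / 2"
        using d(2)[of t] t True \<delta> s by (auto simp: dist_real_def)
      moreover have "dist (y s) x \<ge> r"
        using r(2) x by (auto simp: not_less[symmetric])
      ultimately have "\<epsilon> \<le> norm (x - y t)"
        using dist_triangle[of "y s" x "y t"] by (simp add: \<epsilon>_def dist_commute dist_norm[symmetric])
      then have "\<epsilon>\<^sup>2 \<le> (norm (x - y t))\<^sup>2"
        using r(1) by (intro power_mono) (auto simp: \<epsilon>_def)
      also have "\<dots> \<le> exp (c * t) * (norm (x - y t))\<^sup>2"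
        using c t(1) mult_right_mono[of 1 "exp (c * t)" "(norm (x - y t))\<^sup>2"] by simp
      finally have "\<epsilon>\<^sup>2 \<le> exp (c * t) * (norm (x - y t))\<^sup>2" .
      moreover have "0 \<le> A * (max 0 (s + \<delta> - t))\<^sup>2"
        using A by simp
      ultimately show ?thesis
        unfolding tube_def fst_conv snd_conv by linarith
    next
      case False
      have "\<epsilon>\<^sup>2 = A * \<delta>\<^sup>2"
        using \<delta>(1) by (simp add: A_def)
      also have "\<dots> \<le> A * (max 0 (s + \<delta> - t))\<^sup>2"
        using A False \<delta>(1) by (intro mult_left_mono power_mono) auto
      finally have "\<epsilon>\<^sup>2 \<le> A * (max 0 (s + \<delta> - t))\<^sup>2" .
      moreover have "0 \<le> exp (c * t) * (norm (x - y t))\<^sup>2"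
        by simp
      ultimately show ?thesis
        unfolding tube_def fst_conv snd_conv by linarith
    qed
  qed
qed

text \<open>
  Every point of \<open>\<Omega>\<close> outside the reachable set is in a \<open>\<mu>\<^sub>p\<close>-null tube around the solution through it:
  the tube of \<open>exit_tube\<close> if this solution leaves \<open>X\<close> at an earlier time, and otherwise a tube whose
  section at time 0 misses the closed set \<open>X\<^sub>0\<close>. Countably many of these tubes suffice.
\<close>

lemma feasible_terminal_measure_on_reachable_set:
  fixes f\<^sub>0 :: "real \<times> (real ^ 'n) \<Rightarrow> real ^ 'n"
  assumes poly_f0: "polynomial_function f\<^sub>0"
    and poly_N: "\<And>l. l \<in> {1..L} \<Longrightarrow> polynomial_function (N l)"
    and poly_D: "\<And>l. l \<in> {1..L} \<Longrightarrow> polynomial_function (D l)"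
    and X: "compact X" and X0: "compact X\<^sub>0" "X\<^sub>0 \<subseteq> X" and T: "T > 0"
    and D_pos: "\<And>l z. l \<in> {1..L} \<Longrightarrow> z \<in> {0..T} \<times> X \<Longrightarrow> D l z > 0"
    and feas: "feasible_sum_of_rational f\<^sub>0 L N D T X\<^sub>0 X \<mu>\<^sub>0 \<mu> \<mu>\<^sub>p \<nu>"
  shows "AE z in \<mu>\<^sub>p. z \<in> reachable_set f\<^sub>0 L N D T X\<^sub>0 X"
proof (cases "X = {}")
  case True
  then have "space \<mu>\<^sub>p = {}"
    using feas space_borel_measures_on[of \<mu>\<^sub>p] by (auto simp: feasible_sum_of_rational_def)
  then show ?thesis
    by (intro AE_I2) auto
next
  case False
  define \<Omega> where "\<Omega> = {0..T} \<times> X"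
  have \<Omega>: "compact \<Omega>" "\<Omega> \<noteq> {}"
    using X T False by (auto simp: \<Omega>_def compact_Times)
  have \<mu>p: "\<mu>\<^sub>p \<in> borel_measures_on \<Omega>"
    using feas by (auto simp: feasible_sum_of_rational_def \<Omega>_def)
  obtain F K where F: "K-lipschitz_on UNIV F" and F_eq: "\<And>z. z \<in> \<Omega> \<Longrightarrow> F z = rational_field f\<^sub>0 L N D z"
    by (rule rational_field_lipschitz_extension[of f\<^sub>0 L N D \<Omega>])
       (use poly_f0 poly_N poly_D \<Omega> D_pos[folded \<Omega>_def] in simp_all)
  have K: "K \<ge> 0"
    using F by (rule lipschitz_on_nonneg)
  have F_cont: "continuous_on UNIV F"
    using F by (rule lipschitz_on_continuous_on)
  have cont: "continuous_on S f\<^sub>0" "\<And>l. l \<in> {1..L} \<Longrightarrow> continuous_on S (N l)"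
    "\<And>l. l \<in> {1..L} \<Longrightarrow> continuous_on S (D l)" for S
    using poly_f0 poly_N poly_D by (auto intro: continuous_on_polymonial_function)
  define R where "R = reachable_set f\<^sub>0 L N D T X\<^sub>0 X"
  have cover: "\<exists>W. openin (top_of_set \<Omega>) W \<and> z\<^sub>1 \<in> W \<and> (AE z in \<mu>\<^sub>p. z \<notin> W)"
    if z1: "z\<^sub>1 \<in> \<Omega> - R" for z\<^sub>1
  proof -
    obtain t1 x1 where tx: "z\<^sub>1 = (t1, x1)" by (cases z\<^sub>1)
    have t1: "0 \<le> t1" "t1 \<le> T" and x1: "x1 \<in> X"
      using z1 by (auto simp: \<Omega>_def tx)
    obtain y where y1: "y t1 = x1"
      and y: "\<And>t. t \<in> {-1..T + 1} \<Longrightarrow> (y has_vector_derivative F (t, y t)) (at t within {-1..T + 1})"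
      using lipschitz_ode_solution[OF F, of t1 "-1" "T + 1" x1] t1 T by auto
    have y_cont: "continuous_on {-1..T + 1} y"
      using y by (meson continuous_on_eq_continuous_within has_vector_derivative_continuous)
    have tube_separates: ?thesis
      if \<epsilon>: "\<epsilon> > 0" and \<sigma>: "\<sigma> \<le> t1"
        and cutoff: "\<And>z. z \<in> {0..T} \<times> X \<Longrightarrow> fst z < \<sigma> \<Longrightarrow> tube y (2 * K) \<epsilon> A \<sigma> z \<le> 0"
        and initial: "\<And>x. x \<in> X\<^sub>0 \<Longrightarrow> tube y (2 * K) \<epsilon> A \<sigma> (0, x) \<le> 0"
      for \<epsilon> A \<sigma>
    proof -
      define q where "q = tube y (2 * K) \<epsilon> A \<sigma>"
      have q: "AE z in \<mu>\<^sub>p. q z \<le> 0" "continuous_on \<Omega> q"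
        using feasible_tube_null[OF feas X cont D_pos F F_eq[unfolded \<Omega>_def] _ _ y cutoff initial]
        by (auto simp: q_def \<Omega>_def)
      define W where "W = \<Omega> \<inter> q -` {0<..}"
      have "openin (top_of_set \<Omega>) W"
        unfolding W_def using q(2) by (rule continuous_openin_preimage_gen) simp
      moreover have "q z\<^sub>1 = \<epsilon>\<^sup>2"
        using \<sigma> y1 by (simp add: q_def tube_def tx max_absorb1)
      then have "z\<^sub>1 \<in> W"
        using z1 \<epsilon> by (simp add: W_def)
      moreover have "AE z in \<mu>\<^sub>p. z \<notin> W"
        using q(1) by eventually_elim (simp add: W_def)
      ultimately show ?thesis by blast
    qed
    show ?thesis
    proof (cases "\<forall>s\<in>{0..t1}. y s \<in> X")
      case True
      have in_\<Omega>: "(s, y s) \<in> \<Omega>" if "s \<in> {0..t1}" for s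
        using True that t1 by (auto simp: \<Omega>_def)
      have "is_trajectory f\<^sub>0 L N D (y 0) t1 y"
      proof (rule ode_solution_is_trajectory[OF F_cont])
        fix s
        assume s: "s \<in> {0..t1}"
        show "(y has_vector_derivative F (s, y s)) (at s within {0..t1})"
          using y[of s] s t1 by (auto intro: has_vector_derivative_within_subset)
        show "F (s, y s) = rational_field f\<^sub>0 L N D (s, y s)"
          using F_eq in_\<Omega>[OF s] by simp
        show "D l (s, y s) \<noteq> 0" if "l \<in> {1..L}" for l
          using D_pos[OF that] in_\<Omega>[OF s] by (force simp: \<Omega>_def)
      qed
      then have "y 0 \<notin> X\<^sub>0"
        using z1 True t1 y1 by (auto simp: R_def reachable_set_def tx)
      moreover have "closed X\<^sub>0"
        using X0(1) by (rule compact_imp_closed)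
      ultimately have "\<exists>\<epsilon>>0. ball (y 0) \<epsilon> \<subseteq> - X\<^sub>0"
        using open_contains_ball_eq[of "- X\<^sub>0"] by (simp add: open_Compl)
      then obtain \<epsilon> where \<epsilon>: "\<epsilon> > 0" "ball (y 0) \<epsilon> \<inter> X\<^sub>0 = {}"
        by blast
      show ?thesis
      \<comment> \<open>On \<Omega> no time lies before \<sigma> = 0, so that the tube needs no closing term.\<close>
      proof (rule tube_separates[of \<epsilon> 0 0])
        fix x
        assume "x \<in> X\<^sub>0"
        then have "\<epsilon> \<le> norm (x - y 0)"
          using \<epsilon>(2) by (auto simp: dist_norm norm_minus_commute not_less[symmetric])
        then have "\<epsilon>\<^sup>2 \<le> (norm (x - y 0))\<^sup>2"
          using \<epsilon>(1) by (intro power_mono) auto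
        then show "tube y (2 * K) \<epsilon> 0 0 (0, x) \<le> 0"
          by (simp add: tube_def)
      qed (use \<epsilon> t1 in auto)
    next
      case False
      then obtain s where s: "0 \<le> s" "s < t1" "y s \<notin> X"
        using y1 x1 by (metis atLeastAtMost_iff order_le_less)
      obtain \<epsilon> A \<sigma> where tube: "s < \<sigma>" "\<sigma> \<le> t1" "\<epsilon> > 0"
        "\<And>t x. 0 \<le> t \<Longrightarrow> t < \<sigma> \<Longrightarrow> x \<in> X \<Longrightarrow> tube y (2 * K) \<epsilon> A \<sigma> (t, x) \<le> 0"
        by (rule exit_tube[OF compact_imp_closed[OF X] y_cont, of s t1 "2 * K"]) (use s t1 K in auto)
      show ?thesis
      proof (rule tube_separates[of \<epsilon> \<sigma> A])
        show "tube y (2 * K) \<epsilon> A \<sigma> z \<le> 0" if "z \<in> {0..T} \<times> X" "fst z < \<sigma>" for z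
          using tube(4)[of "fst z" "snd z"] that by auto
        show "tube y (2 * K) \<epsilon> A \<sigma> (0, x) \<le> 0" if "x \<in> X\<^sub>0" for x
          using tube(1,4) s X0(2) that by auto
      qed (use tube in auto)
    qed
  qed
  define \<W> where "\<W> = {W. openin (top_of_set \<Omega>) W \<and> (AE z in \<mu>\<^sub>p. z \<notin> W)}"
  have "\<And>W. W \<in> \<W> \<Longrightarrow> openin (top_of_set \<Omega>) W"
    by (simp add: \<W>_def)
  then obtain \<V> where \<V>: "\<V> \<subseteq> \<W>" "countable \<V>" "\<Union>\<V> = \<Union>\<W>"
    using Lindelof_openin by metis
  have "AE z in \<mu>\<^sub>p. \<forall>W\<in>\<V>. z \<notin> W"
    using \<V> by (subst AE_ball_countable) (auto simp: \<W>_def)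
  moreover have "AE z in \<mu>\<^sub>p. z \<in> \<Omega>"
    using space_borel_measures_on[OF \<mu>p] by (intro AE_I2) simp
  ultimately have "AE z in \<mu>\<^sub>p. z \<in> R"
  proof eventually_elim
    case (elim z)
    show ?case
    proof (rule ccontr)
      assume "z \<notin> R"
      with cover elim(2) obtain W where "z \<in> W" "W \<in> \<W>"
        unfolding \<W>_def by blast
      then have "z \<in> \<Union>\<V>"
        using \<V>(3) by blast
      with elim(1) show False by blast
    qed
  qed
  then show ?thesis
    by (simp add: R_def)
qed

section \<open>Feasible measures from trajectories\<close>

text \<open>
  An absolutely continuous curve is the integral of its almost everywhere derivative. Here this
  derivative is the continuous function \<open>f(t, x(t))\<close>, so the integral is differentiable everywhere.
\<close>

lemma trajectory_in_state_space_is_C1: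
  fixes f\<^sub>0 :: "real \<times> (real ^ 'n) \<Rightarrow> real ^ 'n"
  assumes traj: "is_trajectory f\<^sub>0 L N D x\<^sub>0 \<tau> x"
    and stay: "\<And>t. t \<in> {0..\<tau>} \<Longrightarrow> (t, x t) \<in> \<Omega>"
    and f: "continuous_on \<Omega> (rational_field f\<^sub>0 L N D)"
    and t: "t \<in> {0..\<tau>}"
  shows "(x has_vector_derivative rational_field f\<^sub>0 L N D (t, x t)) (at t within {0..\<tau>})"
proof -
  define g where "g s = rational_field f\<^sub>0 L N D (s, x s)" for s
  have ac: "absolutely_continuous_curve 0 \<tau> x"
    using traj by (simp add: is_trajectory_def)
  have "AE s in lborel. s \<in> {0..\<tau>} \<longrightarrow> (x has_vector_derivative g s) (at s within {0..\<tau>})"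
    using traj unfolding is_trajectory_def g_def by (auto elim: AE_mp)
  then obtain E where E: "E \<in> null_sets lborel"
    and der: "\<And>s. s \<in> {0..\<tau>} \<Longrightarrow> s \<notin> E \<Longrightarrow> (x has_vector_derivative g s) (at s within {0..\<tau>})"
    unfolding eventually_ae_filter by auto
  have x_cont: "continuous_on {0..\<tau>} x"
    using ac by (rule absolutely_continuous_curve_imp_continuous_on)
  have g_cont: "continuous_on {0..\<tau>} g"
    unfolding g_def using stay by (intro continuous_on_compose2[OF f] continuous_intros x_cont) auto
  have x_eq: "x s = x 0 + integral {0..s} g" if s: "s \<in> {0..\<tau>}" for s
  proof -
    have "(g has_integral x s - x 0) {0..s}"
    proof (rule fundamental_theorem_of_calculus_absolutely_continuous[OF _ _ E])
      show "absolutely_continuous_curve 0 s x"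
        using s by (intro absolutely_continuous_curve_subinterval[OF ac]) auto
      show "(x has_vector_derivative g r) (at r within {0..s})" if "r \<in> {0..s}" "r \<notin> E" for r
        using der[of r] that s by (auto intro: has_vector_derivative_within_subset)
    qed (use s in auto)
    from integral_unique[OF this] show ?thesis by simp
  qed
  have "((\<lambda>s. integral {0..s} g) has_vector_derivative g t) (at t within {0..\<tau>})"
    using g_cont t by (rule integral_has_vector_derivative)
  then have "((\<lambda>s. x 0 + integral {0..s} g) has_vector_derivative g t) (at t within {0..\<tau>})"
    by (auto intro!: derivative_eq_intros)
  then have "(x has_vector_derivative g t) (at t within {0..\<tau>})"
    by (rule has_vector_derivative_transform[OF t, rotated]) (rule x_eq)
  then show ?thesis
    by (simp add: g_def)
qed

definition occupation_measure :: "real \<Rightarrow> (real \<Rightarrow> 'a) \<Rightarrow> (real \<times> 'a::euclidean_space) set \<Rightarrow> (real \<times> 'a) measure"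
  where "occupation_measure \<tau> x \<Omega> =
    distr (restrict_space lborel {0..\<tau>}) (restrict_space borel \<Omega>) (\<lambda>t. (t, x t))"

lemma graph_measurable:
  fixes x :: "real \<Rightarrow> 'a::euclidean_space"
  assumes x: "continuous_on {0..\<tau>} x" and stay: "\<And>t. t \<in> {0..\<tau>} \<Longrightarrow> (t, x t) \<in> \<Omega>"
  shows "(\<lambda>t. (t, x t)) \<in> restrict_space lborel {0..\<tau>} \<rightarrow>\<^sub>M restrict_space borel \<Omega>"
proof (rule measurable_restrict_space2)
  have "(\<lambda>t. (t, x t)) \<in> borel_measurable (restrict_space borel {0..\<tau>})"
    by (intro borel_measurable_continuous_on_restrict continuous_intros x)
  moreover have "sets (restrict_space lborel {0..\<tau>}) = sets (restrict_space borel {0..\<tau>})"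
    by (simp add: sets_restrict_space)
  ultimately show "(\<lambda>t. (t, x t)) \<in> borel_measurable (restrict_space lborel {0..\<tau>})"
    by (simp cong: measurable_cong_sets)
qed (use stay in \<open>simp add: space_restrict_space\<close>)

lemma occupation_measure_in_borel_measures_on:
  fixes x :: "real \<Rightarrow> 'a::euclidean_space"
  assumes "continuous_on {0..\<tau>} x" "\<And>t. t \<in> {0..\<tau>} \<Longrightarrow> (t, x t) \<in> \<Omega>"
  shows "occupation_measure \<tau> x \<Omega> \<in> borel_measures_on \<Omega>"
proof -
  have "finite_measure (restrict_space lborel {0..\<tau>})"
    by (intro finite_measureI) (simp add: space_restrict_space emeasure_restrict_space emeasure_lborel_Icc_eq)
  then have "finite_measure (occupation_measure \<tau> x \<Omega>)"
    unfolding occupation_measure_def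
    by (rule finite_measure.finite_measure_distr) (rule graph_measurable[OF assms])
  then show ?thesis
    by (simp add: borel_measures_on_def occupation_measure_def)
qed

lemma integral_occupation_measure:
  fixes x :: "real \<Rightarrow> 'a::euclidean_space" and g :: "real \<times> 'a \<Rightarrow> real"
  assumes x: "continuous_on {0..\<tau>} x" and stay: "\<And>t. t \<in> {0..\<tau>} \<Longrightarrow> (t, x t) \<in> \<Omega>"
    and g: "continuous_on \<Omega> g"
  shows "(\<integral>z. g z \<partial>occupation_measure \<tau> x \<Omega>) = integral {0..\<tau>} (\<lambda>t. g (t, x t))"
proof -
  have cont: "continuous_on {0..\<tau>} (\<lambda>t. g (t, x t))"
    using stay by (intro continuous_on_compose2[OF g] continuous_intros x) auto
  have "(\<integral>z. g z \<partial>occupation_measure \<tau> x \<Omega>) = (\<integral>t. g (t, x t) \<partial>restrict_space lborel {0..\<tau>})"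
    unfolding occupation_measure_def
    by (rule integral_distr[OF graph_measurable[OF x stay] borel_measurable_continuous_on_restrict[OF g]])
  also have "\<dots> = (LINT t:{0..\<tau>}|lborel. g (t, x t))"
    by (simp add: integral_restrict_space set_lebesgue_integral_def)
  also have "\<dots> = integral {0..\<tau>} (\<lambda>t. g (t, x t))"
    using borel_integrable_atLeastAtMost'[OF cont] by (rule set_borel_integral_eq_integral)
  finally show ?thesis .
qed

text \<open>
  The measure \<open>\<nu> l\<close> that \<open>D l\<close> and \<open>\<mu>\<close> determine; it is finite because \<open>1 / D l\<close> is continuous on a
  compact set.
\<close>

lemma density_inverse_in_borel_measures_on:
  fixes d :: "'a::{second_countable_topology, t2_space} \<Rightarrow> real"
  assumes \<mu>: "\<mu> \<in> borel_measures_on \<Omega>" and \<Omega>: "compact \<Omega>"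
    and d: "continuous_on \<Omega> d" and pos: "\<And>z. z \<in> \<Omega> \<Longrightarrow> d z > 0"
  shows "density \<mu> (\<lambda>z. 1 / d z) \<in> borel_measures_on \<Omega>"
    and "\<And>\<omega>. continuous_on \<Omega> \<omega> \<Longrightarrow> (\<integral>z. \<omega> z * d z \<partial>density \<mu> (\<lambda>z. 1 / d z)) = (\<integral>z. \<omega> z \<partial>\<mu>)"
proof -
  have space: "space \<mu> = \<Omega>"
    using \<mu> by (rule space_borel_measures_on)
  have "continuous_on \<Omega> (\<lambda>z. 1 / d z)"
    using pos by (intro continuous_intros d) force
  then have int: "integrable \<mu> (\<lambda>z. 1 / d z)"
    by (rule integrable_continuous_borel_measures_on[OF \<mu> \<Omega>])
  have nonneg: "AE z in \<mu>. 0 \<le> 1 / d z"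
    using pos space by (intro AE_I2) (simp add: less_imp_le)
  have "emeasure (density \<mu> (\<lambda>z. 1 / d z)) \<Omega> = (\<integral>\<^sup>+z. ennreal (1 / d z) \<partial>\<mu>)"
    using borel_measurable_integrable[OF int] space
    by (subst emeasure_density) (auto intro!: nn_integral_cong simp: sets.top[of \<mu>, unfolded space])
  also have "\<dots> = ennreal (\<integral>z. 1 / d z \<partial>\<mu>)"
    using int nonneg by (rule nn_integral_eq_integral)
  finally have "finite_measure (density \<mu> (\<lambda>z. 1 / d z))"
    by (intro finite_measureI) (simp add: space)
  then show "density \<mu> (\<lambda>z. 1 / d z) \<in> borel_measures_on \<Omega>"
    using \<mu> by (simp add: borel_measures_on_def)
  fix \<omega> :: "'a \<Rightarrow> real"
  assume \<omega>: "continuous_on \<Omega> \<omega>"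
  have "integrable \<mu> (\<lambda>z. \<omega> z * d z)"
    by (intro integrable_continuous_borel_measures_on[OF \<mu> \<Omega>] continuous_intros \<omega> d)
  then have "(\<integral>z. \<omega> z * d z \<partial>density \<mu> (\<lambda>z. 1 / d z)) = (\<integral>z. (1 / d z) *\<^sub>R (\<omega> z * d z) \<partial>\<mu>)"
    by (intro integral_density borel_measurable_integrable int nonneg)
  also have "\<dots> = (\<integral>z. \<omega> z \<partial>\<mu>)"
    using pos space by (intro Bochner_Integration.integral_cong refl) force
  finally show "(\<integral>z. \<omega> z * d z \<partial>density \<mu> (\<lambda>z. 1 / d z)) = (\<integral>z. \<omega> z \<partial>\<mu>)" .
qed

lemma return_in_borel_measures_on:
  assumes "z \<in> S"
  shows "return (restrict_space borel S) z \<in> borel_measures_on S"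
proof -
  have "prob_space (return (restrict_space borel S) z)"
    using assms by (intro prob_space_return) (simp add: space_restrict_space)
  then show ?thesis
    by (simp add: borel_measures_on_def prob_space.finite_measure)
qed

lemma integral_return_continuous_on:
  fixes g :: "'a::topological_space \<Rightarrow> real"
  assumes "continuous_on S g" "z \<in> S"
  shows "(\<integral>w. g w \<partial>return (restrict_space borel S) z) = g z"
  using assms by (intro integral_return borel_measurable_continuous_on_restrict) (simp add: space_restrict_space)

text \<open>
  The Liouville equation, tested with \<open>v\<close>, says that the increment of \<open>t \<mapsto> v(t, x(t))\<close> from 0 to \<open>\<tau>\<close> is
  the integral of its derivative.
\<close>

lemma trajectory_measures_feasible:
  fixes f\<^sub>0 :: "real \<times> (real ^ 'n) \<Rightarrow> real ^ 'n"
  assumes X: "compact X" "X\<^sub>0 \<subseteq> X"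
    and f0: "continuous_on ({0..T} \<times> X) f\<^sub>0"
    and N: "\<And>l. l \<in> {1..L} \<Longrightarrow> continuous_on ({0..T} \<times> X) (N l)"
    and D: "\<And>l. l \<in> {1..L} \<Longrightarrow> continuous_on ({0..T} \<times> X) (D l)"
    and D_pos: "\<And>l z. l \<in> {1..L} \<Longrightarrow> z \<in> {0..T} \<times> X \<Longrightarrow> D l z > 0"
    and traj: "is_trajectory f\<^sub>0 L N D x\<^sub>0 \<tau> x" and \<tau>: "\<tau> \<in> {0..T}" and x0: "x\<^sub>0 \<in> X\<^sub>0"
    and stay: "\<And>t. t \<in> {0..\<tau>} \<Longrightarrow> x t \<in> X"
  defines "\<mu> \<equiv> occupation_measure \<tau> x ({0..T} \<times> X)"
  shows "feasible_sum_of_rational f\<^sub>0 L N D T X\<^sub>0 X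
    (return (restrict_space borel X\<^sub>0) x\<^sub>0) \<mu>
    (return (restrict_space borel ({0..T} \<times> X)) (\<tau>, x \<tau>)) (\<lambda>l. density \<mu> (\<lambda>z. 1 / D l z))"
proof -
  define \<Omega> where "\<Omega> = {0..T} \<times> X"
  define f where "f = rational_field f\<^sub>0 L N D"
  have \<Omega>: "compact \<Omega>"
    using X by (simp add: \<Omega>_def compact_Times)
  note cont = f0[folded \<Omega>_def] N[folded \<Omega>_def] D[folded \<Omega>_def]
  note pos = D_pos[folded \<Omega>_def]
  have graph: "(t, x t) \<in> \<Omega>" if "t \<in> {0..\<tau>}" for t
    using that stay \<tau> by (auto simp: \<Omega>_def)
  have f_cont: "continuous_on \<Omega> f"
    unfolding f_def rational_field_def[abs_def]
    using pos by (intro continuous_intros cont) force+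
  have x_cont: "continuous_on {0..\<tau>} x"
    using traj by (simp add: is_trajectory_def absolutely_continuous_curve_imp_continuous_on)
  have x_start: "x 0 = x\<^sub>0"
    using traj by (simp add: is_trajectory_def)
  have x_der: "(x has_vector_derivative f (t, x t)) (at t within {0..\<tau>})" if "t \<in> {0..\<tau>}" for t
    unfolding f_def using trajectory_in_state_space_is_C1[OF traj graph f_cont[unfolded f_def] that] .
  have \<mu>: "\<mu> \<in> borel_measures_on \<Omega>"
    unfolding \<mu>_def \<Omega>_def[symmetric]
    using x_cont graph by (rule occupation_measure_in_borel_measures_on)
  note \<nu> = density_inverse_in_borel_measures_on[OF \<mu> \<Omega> cont(3) pos]
  have "(\<integral>z. v z \<partial>return (restrict_space borel \<Omega>) (\<tau>, x \<tau>))
      = (\<integral>x. v (0, x) \<partial>return (restrict_space borel X\<^sub>0) x\<^sub>0) + (\<integral>z. lie_deriv f\<^sub>0 v z \<partial>\<mu>)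
         + (\<Sum>l=1..L. \<integral>z. N l z \<bullet> space_grad v z \<partial>density \<mu> (\<lambda>z. 1 / D l z))"
    if v: "C1_on_nbhd \<Omega> v" for v
  proof -
    obtain U v' where U: "\<Omega> \<subseteq> U" and v'_cont: "continuous_on U v'"
      and v': "\<And>z. z \<in> U \<Longrightarrow> (v has_derivative blinfun_apply (v' z)) (at z)"
      using v unfolding C1_on_nbhd_def by blast
    have v'_cont_\<Omega>: "continuous_on \<Omega> v'"
      using v'_cont U by (rule continuous_on_subset)
    have v'_\<Omega>: "(v has_derivative blinfun_apply (v' z)) (at z)" if "z \<in> \<Omega>" for z
      using v' U that by blast
    have v_cont: "continuous_on \<Omega> v"
      using v'_\<Omega> by (meson continuous_at_imp_continuous_on has_derivative_continuous)
    have v0_cont: "continuous_on X\<^sub>0 (\<lambda>x. v (0, x))"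
      using \<tau> X(2) by (intro continuous_on_compose2[OF v_cont] continuous_intros) (auto simp: \<Omega>_def)
    have "((\<lambda>t. v (t, x t)) has_vector_derivative v' (t, x t) (1, f (t, x t))) (at t within {0..\<tau>})"
      if t: "t \<in> {0..\<tau>}" for t
    proof -
      have "((\<lambda>t. (t, x t)) has_vector_derivative (1, f (t, x t))) (at t within {0..\<tau>})"
        using x_der[OF t] by (intro has_vector_derivative_Pair) (auto intro!: derivative_eq_intros)
      from vector_derivative_diff_chain_within[OF this has_derivative_at_withinI[OF v'_\<Omega>[OF graph[OF t]]]]
      show ?thesis
        by (simp add: o_def)
    qed
    then have "((\<lambda>t. v' (t, x t) (1, f (t, x t))) has_integral v (\<tau>, x \<tau>) - v (0, x 0)) {0..\<tau>}"
      using \<tau> by (intro fundamental_theorem_of_calculus) auto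
    then have "v (\<tau>, x \<tau>) - v (0, x 0) = integral {0..\<tau>} (\<lambda>t. v' (t, x t) (1, f (t, x t)))"
      by (rule integral_unique[symmetric])
    moreover have "(\<integral>z. v' z (1, f z) \<partial>\<mu>) = integral {0..\<tau>} (\<lambda>t. v' (t, x t) (1, f (t, x t)))"
      unfolding \<mu>_def \<Omega>_def[symmetric]
      by (rule integral_occupation_measure[OF x_cont graph])
         (auto intro!: continuous_intros v'_cont_\<Omega> f_cont)
    moreover have "(\<integral>z. lie_deriv f\<^sub>0 v z \<partial>\<mu>)
        + (\<Sum>l=1..L. \<integral>z. N l z \<bullet> space_grad v z \<partial>density \<mu> (\<lambda>z. 1 / D l z)) = (\<integral>z. v' z (1, f z) \<partial>\<mu>)"
      unfolding f_def
      by (rule lie_deriv_rational_field_pairing[OF \<Omega> \<mu> \<nu> cont pos v'_cont_\<Omega> v'_\<Omega>])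
    moreover have "(\<integral>z. v z \<partial>return (restrict_space borel \<Omega>) (\<tau>, x \<tau>)) = v (\<tau>, x \<tau>)"
      using v_cont graph[of \<tau>] \<tau> by (intro integral_return_continuous_on) auto
    moreover have "(\<integral>x. v (0, x) \<partial>return (restrict_space borel X\<^sub>0) x\<^sub>0) = v (0, x 0)"
      using integral_return_continuous_on[OF v0_cont x0] x_start by simp
    ultimately show ?thesis by linarith
  qed
  moreover have "return (restrict_space borel \<Omega>) (\<tau>, x \<tau>) \<in> borel_measures_on \<Omega>"
    using graph[of \<tau>] \<tau> by (intro return_in_borel_measures_on) auto
  ultimately show ?thesis
    unfolding feasible_sum_of_rational_def \<Omega>_def[symmetric]
    using \<mu> \<nu> x0 return_in_borel_measures_on[OF x0] integral_return_continuous_on[of X\<^sub>0 "\<lambda>_. 1"]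
    by auto
qed

section \<open>Equality of the optimal values\<close>

text \<open>
  The constant 1 as a test function transfers the mass of \<open>\<mu>\<^sub>0\<close> to \<open>\<mu>\<^sub>p\<close>.
\<close>

lemma feasible_terminal_measure_mass:
  fixes f\<^sub>0 :: "real \<times> (real ^ 'n) \<Rightarrow> real ^ 'n"
  assumes feas: "feasible_sum_of_rational f\<^sub>0 L N D T X\<^sub>0 X \<mu>\<^sub>0 \<mu> \<mu>\<^sub>p \<nu>"
  shows "measure \<mu>\<^sub>p (space \<mu>\<^sub>p) = 1"
proof -
  let ?one = "\<lambda>z :: real \<times> (real ^ 'n). 1 :: real"
  have der: "(?one has_derivative (\<lambda>h. 0)) (at z)" for z
    by simp
  have "C1_on_nbhd ({0..T} \<times> X) ?one"
    unfolding C1_on_nbhd_def by (intro exI[of _ UNIV] exI[of _ "\<lambda>_. 0"]) (simp add: zero_blinfun.rep_eq)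
  then have "(\<integral>z. 1 \<partial>\<mu>\<^sub>p) = (\<integral>x. 1 \<partial>\<mu>\<^sub>0) + (\<integral>z. lie_deriv f\<^sub>0 ?one z \<partial>\<mu>)
      + (\<Sum>l=1..L. \<integral>z. N l z \<bullet> space_grad ?one z \<partial>\<nu> l)"
    using feas unfolding feasible_sum_of_rational_def by blast
  also have "\<dots> = 1"
    using feas by (simp add: feasible_sum_of_rational_def lie_deriv_eq_derivative(2,3)[OF der])
  finally show ?thesis by simp
qed

theorem corollary11:
  fixes f\<^sub>0 :: "real \<times> (real ^ 'n) \<Rightarrow> real ^ 'n"
    and L :: nat
    and N :: "nat \<Rightarrow> real \<times> (real ^ 'n) \<Rightarrow> real ^ 'n"
    and D :: "nat \<Rightarrow> real \<times> (real ^ 'n) \<Rightarrow> real"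
    and T :: real
    and X\<^sub>0 X :: "(real ^ 'n) set"
    and p :: "real ^ 'n \<Rightarrow> real"
  assumes T_pos: "T > 0"
    and X0_subset: "X\<^sub>0 \<subseteq> X"
    and poly_f0: "polynomial_function f\<^sub>0"
    and poly_N: "\<And>l. l \<in> {1..L} \<Longrightarrow> polynomial_function (N l)"
    and poly_D: "\<And>l. l \<in> {1..L} \<Longrightarrow> polynomial_function (D l)"
    and A1: "non_return f\<^sub>0 L N D T X\<^sub>0 X"
    and A2: "compact ({0..T} \<times> X\<^sub>0 \<times> X)"
    and A3: "continuous_on X p"
    and A4: "unique_trajectories f\<^sub>0 L N D T X\<^sub>0"
    and A5: "\<And>l z. l \<in> {1..L} \<Longrightarrow> z \<in> {0..T} \<times> X \<Longrightarrow> D l z > 0"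
  shows "peak_value f\<^sub>0 L N D T X\<^sub>0 X p = sum_of_rational_value f\<^sub>0 L N D T X\<^sub>0 X p"
proof (rule antisym)
  define \<Omega> where "\<Omega> = {0..T} \<times> X"
  define R where "R = reachable_set f\<^sub>0 L N D T X\<^sub>0 X"
  \<comment> \<open>For empty \<open>X\<^sub>0\<close> the product is compact whatever \<open>X\<close> is; then there is neither a
    trajectory nor a feasible point, and both suprema are taken over the empty set.\<close>
  have compact: "compact X\<^sub>0" "compact X" if "X\<^sub>0 \<noteq> {}"
  proof -
    have "compact ((\<lambda>z. fst (snd z)) ` ({0..T} \<times> X\<^sub>0 \<times> X))" "compact ((\<lambda>z. snd (snd z)) ` ({0..T} \<times> X\<^sub>0 \<times> X))"
      using A2 by (auto intro!: compact_continuous_image continuous_intros)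
    moreover have "(\<lambda>z. fst (snd z)) ` ({0..T} \<times> X\<^sub>0 \<times> X) = X\<^sub>0" "(\<lambda>z. snd (snd z)) ` ({0..T} \<times> X\<^sub>0 \<times> X) = X"
      using that X0_subset T_pos by (force simp: image_iff)+
    ultimately show "compact X\<^sub>0" "compact X"
      by simp_all
  qed
  have cont: "continuous_on S f\<^sub>0" "\<And>l. l \<in> {1..L} \<Longrightarrow> continuous_on S (N l)"
    "\<And>l. l \<in> {1..L} \<Longrightarrow> continuous_on S (D l)" for S
    using poly_f0 poly_N poly_D by (auto intro: continuous_on_polymonial_function)
  have p_cont: "continuous_on \<Omega> (\<lambda>z. p (snd z))"
    by (rule continuous_on_compose2[OF A3]) (auto simp: \<Omega>_def intro!: continuous_intros)

  show "peak_value f\<^sub>0 L N D T X\<^sub>0 X p \<le> sum_of_rational_value f\<^sub>0 L N D T X\<^sub>0 X p"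
    unfolding peak_value_eq_reachable_set
  proof (rule SUP_least)
    fix z
    assume "z \<in> reachable_set f\<^sub>0 L N D T X\<^sub>0 X"
    then obtain \<tau> x x\<^sub>0 where z: "z = (\<tau>, x \<tau>)" and \<tau>: "\<tau> \<in> {0..T}" and x0: "x\<^sub>0 \<in> X\<^sub>0"
      and traj: "is_trajectory f\<^sub>0 L N D x\<^sub>0 \<tau> x" and stay: "\<And>t. t \<in> {0..\<tau>} \<Longrightarrow> x t \<in> X"
      by (auto simp: reachable_set_def)
    have X: "compact X"
      using x0 by (intro compact) auto
    let ?\<mu>p = "return (restrict_space borel \<Omega>) z"
    have "(\<integral>w. p (snd w) \<partial>?\<mu>p) = p (snd z)"
      using \<tau> stay[of \<tau>] by (intro integral_return_continuous_on[OF p_cont]) (auto simp: z \<Omega>_def)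
    then have "ereal (p (snd z)) = ereal (\<integral>(t, x). p x \<partial>?\<mu>p)"
      by (simp add: case_prod_unfold)
    also have "\<dots> \<le> sum_of_rational_value f\<^sub>0 L N D T X\<^sub>0 X p"
      unfolding sum_of_rational_value_def
      using trajectory_measures_feasible[OF X X0_subset cont A5 traj \<tau> x0 stay]
      by (intro Sup_upper) (auto simp: z \<Omega>_def)
    finally show "ereal (p (snd z)) \<le> sum_of_rational_value f\<^sub>0 L N D T X\<^sub>0 X p" .
  qed

  show "sum_of_rational_value f\<^sub>0 L N D T X\<^sub>0 X p \<le> peak_value f\<^sub>0 L N D T X\<^sub>0 X p"
    unfolding sum_of_rational_value_def
  proof (rule Sup_least, clarify)
    fix \<mu>\<^sub>0 \<mu> \<mu>\<^sub>p \<nu>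
    assume feas: "feasible_sum_of_rational f\<^sub>0 L N D T X\<^sub>0 X \<mu>\<^sub>0 \<mu> \<mu>\<^sub>p \<nu>"
    have \<mu>0: "\<mu>\<^sub>0 \<in> borel_measures_on X\<^sub>0" "measure \<mu>\<^sub>0 (space \<mu>\<^sub>0) = 1" and \<mu>p: "\<mu>\<^sub>p \<in> borel_measures_on \<Omega>"
      using feas by (auto simp: feasible_sum_of_rational_def \<Omega>_def)
    have "X\<^sub>0 \<noteq> {}"
      using \<mu>0 space_borel_measures_on by force
    note X = compact[OF this]
    have \<Omega>: "compact \<Omega>"
      using X by (simp add: \<Omega>_def compact_Times)
    have mass: "measure \<mu>\<^sub>p (space \<mu>\<^sub>p) = 1"
      using feas by (rule feasible_terminal_measure_mass)
    have reach: "AE z in \<mu>\<^sub>p. z \<in> R"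
      unfolding R_def
      using feasible_terminal_measure_on_reachable_set[OF poly_f0 poly_N poly_D X(2,1) X0_subset T_pos A5 feas] .
    have le_peak: "AE z in \<mu>\<^sub>p. ereal (p (snd z)) \<le> peak_value f\<^sub>0 L N D T X\<^sub>0 X p"
      using reach unfolding peak_value_eq_reachable_set R_def
      by eventually_elim (rule SUP_upper)
    have int: "integrable \<mu>\<^sub>p (\<lambda>z. p (snd z))"
      using p_cont by (rule integrable_continuous_borel_measures_on[OF \<mu>p \<Omega>])
    show "ereal (\<integral>(t, x). p x \<partial>\<mu>\<^sub>p) \<le> peak_value f\<^sub>0 L N D T X\<^sub>0 X p"
    proof (cases "peak_value f\<^sub>0 L N D T X\<^sub>0 X p")
      case (real r)
      interpret finite_measure \<mu>\<^sub>p
        using \<mu>p by (simp add: borel_measures_on_def)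
      have "(\<integral>z. p (snd z) \<partial>\<mu>\<^sub>p) \<le> (\<integral>z. r \<partial>\<mu>\<^sub>p)"
        using le_peak int by (intro integral_mono_AE) (auto simp: real)
      also have "\<dots> = r"
        using mass by simp
      finally show ?thesis
        by (simp add: real case_prod_unfold)
    next
      \<comment> \<open>A probability measure cannot be concentrated on an empty reachable set.\<close>
      case MInf
      have "AE z in \<mu>\<^sub>p. False"
        using le_peak by (simp add: MInf)
      then have "measure \<mu>\<^sub>p (space \<mu>\<^sub>p) = 0"
        by (simp add: AE_iff_measurable[OF sets.top] measure_def)
      then show ?thesis
        using mass by simp
    qed simp
  qed
qed

end
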